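(* Let $k$ be a field of characteristic zero, $R=k[x_0,\ldots,x_4]$, and let $$\mathcal{H}_3=\begin{pmatrix} x_0&x_1&x_2\\ x_1&x_2&x_3\\ x_2&x_3&x_4\end{pmatrix}$$ be the generic $3\times 3$ Hankel matrix. Let $J\subset R$ be the gradient ideal of $\det\mathcal{H}_3$ and let $P:=I_2(\mathcal{H}_3)$. Then $P^2\subset JP$; in particular, $J$ is a minimal reduction of $P$ with reduction number $1$.
   Context: The gradient ideal of a polynomial is the ideal generated by all its partial derivatives. $I_2(\mathcal{H}_3)$ is the ideal generated by the $2\times 2$ minors. An ideal $J\subset P$ is a reduction of $P$ if $P^{r+1}=JP^r$ for some $r\ge 0$; the least such $r$ is the reduction number $\mathrm{red}_J(P)$ of $P$ with respect to $J$. A reduction is minimal if it does not properly contain another reduction of $P$. *)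

theory Defs
  imports
    "HOL-Library.Poly_Mapping"
    "HOL-Library.Numeral_Type"
    "Jordan_Normal_Form.Determinant"
    "Jordan_Normal_Form.DL_Submatrix"
begin

section \<open>Ideals of a commutative ring\<close>

text \<open>A commutative ring is regarded as a module over itself; its submodules are its ideals, and
  the submodule spanned by a set is the ideal generated by that set.\<close>

global_interpretation self_module: Modules.module "(*) :: 'a::comm_ring_1 \<Rightarrow> 'a \<Rightarrow> 'a"
  by standard (simp_all add: algebra_simps)

abbreviation is_ideal :: "'a::comm_ring_1 set \<Rightarrow> bool" where
  "is_ideal \<equiv> Modules.module.subspace (*)"

abbreviation ideal_gen :: "'a::comm_ring_1 set \<Rightarrow> 'a set" where
  "ideal_gen \<equiv> Modules.module.span (*)"

definition ideal_mult :: "'a::comm_ring_1 set \<Rightarrow> 'a set \<Rightarrow> 'a set" where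
  "ideal_mult I J = ideal_gen {a * b | a b. a \<in> I \<and> b \<in> J}"

primrec ideal_power :: "'a::comm_ring_1 set \<Rightarrow> nat \<Rightarrow> 'a set" where
  "ideal_power I 0 = UNIV"
| "ideal_power I (Suc n) = ideal_mult I (ideal_power I n)"


section \<open>Reductions\<close>

definition is_reduction :: "'a::comm_ring_1 set \<Rightarrow> 'a set \<Rightarrow> bool" where
  "is_reduction J P \<longleftrightarrow> is_ideal J \<and> J \<subseteq> P \<and>
     (\<exists>r. ideal_power P (r + 1) = ideal_mult J (ideal_power P r))"

definition is_minimal_reduction :: "'a::comm_ring_1 set \<Rightarrow> 'a set \<Rightarrow> bool" where
  "is_minimal_reduction J P \<longleftrightarrow> is_reduction J P \<and> \<not> (\<exists>J'. is_reduction J' P \<and> J' \<subset> J)"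

text \<open>The value is meaningful only if \<open>J\<close> is a reduction of \<open>P\<close>.\<close>

definition reduction_number :: "'a::comm_ring_1 set \<Rightarrow> 'a set \<Rightarrow> nat" where
  "reduction_number J P = (LEAST r. ideal_power P (r + 1) = ideal_mult J (ideal_power P r))"


section \<open>Polynomials\<close>

text \<open>Finitely supported functions from exponent vectors to coefficients, with the convolution
  product. For a finite type \<open>'v\<close> this is the polynomial ring in \<open>CARD('v)\<close> variables.\<close>

type_synonym ('v, 'k) mpoly = "('v \<Rightarrow>\<^sub>0 nat) \<Rightarrow>\<^sub>0 'k"

definition Var :: "'v \<Rightarrow> ('v, 'k::comm_ring_1) mpoly" where
  "Var v = Poly_Mapping.single (Poly_Mapping.single v 1) 1"

text \<open>Termwise differentiation. The subtraction on exponents is truncated, but the terms in which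
  \<open>v\<close> does not occur get coefficient \<open>0\<close>.\<close>

definition partial_deriv :: "'v \<Rightarrow> ('v, 'k::comm_ring_1) mpoly \<Rightarrow> ('v, 'k) mpoly" where
  "partial_deriv v p = (\<Sum>m\<in>Poly_Mapping.keys p.
     Poly_Mapping.single (m - Poly_Mapping.single v 1)
       (of_nat (Poly_Mapping.lookup m v) * Poly_Mapping.lookup p m))"

definition gradient_ideal :: "('v, 'k::comm_ring_1) mpoly \<Rightarrow> ('v, 'k) mpoly set" where
  "gradient_ideal f = ideal_gen (range (\<lambda>v. partial_deriv v f))"


section \<open>Determinantal ideals and the Hankel matrix\<close>

definition minors :: "nat \<Rightarrow> 'a::comm_ring_1 mat \<Rightarrow> 'a set" where
  "minors t A = {det (submatrix A I J) | I J.
     I \<subseteq> {..<dim_row A} \<and> J \<subseteq> {..<dim_col A} \<and> card I = t \<and> card J = t}"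

definition minors_ideal :: "nat \<Rightarrow> 'a::comm_ring_1 mat \<Rightarrow> 'a set" where
  "minors_ideal t A = ideal_gen (minors t A)"

text \<open>The variables are indexed by the five-element numeral type, whose elements are
  \<open>0, 1, 2, 3, 4\<close>.\<close>

definition hankel3 :: "(5, 'k::comm_ring_1) mpoly mat" where
  "hankel3 = mat_of_rows_list 3
     [[Var 0, Var 1, Var 2],
      [Var 1, Var 2, Var 3],
      [Var 2, Var 3, Var 4]]"

end

theory Submission
  imports Defs "HOL-Algebra.Algebraic_Closure_Type"
begin

text \<open>Let \<open>f\<^sub>0, \<dots>, f\<^sub>4\<close> be the partial derivatives of the determinant and \<open>a = x\<^sub>1 x\<^sub>3 - x\<^sub>2\<^sup>2\<close>. In
  characteristic zero the ideal \<open>P\<close> of minors is generated by the \<open>f\<^sub>i\<close> and \<open>a\<close>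
  (\<open>minors_ideal_hankel3\<close>). The Pluecker relation between the maximal minors of the \<open>2 \<times> 4\<close> Hankel
  matrix reads \<open>12 a\<^sup>2 = 4 f\<^sub>2 a - f\<^sub>1 f\<^sub>3 + 4 f\<^sub>0 f\<^sub>4\<close> (\<open>central_minor_square\<close>). So \<open>a\<^sup>2\<close> lies in
  \<open>J P\<close>, which gives \<open>P\<^sup>2 = J P\<close>. The exponent 0 does not suffice, as \<open>a\<close> is not in \<open>J\<close>
  (\<open>central_minor_not_in_gradient_span\<close>).

  For minimality let \<open>J' \<subseteq> J\<close> with \<open>P\<^sup>r\<^sup>+\<^sup>1 = J' P\<^sup>r\<close>. As the ring is not local and \<open>J'\<close> need not be
  homogeneous, the equality \<open>J' = J\<close> has to be checked at all prime ideals \<open>N\<close> containing \<open>P\<close>, not only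
  at the origin. Let \<open>M\<close> be the module of all \<open>c\<close> with \<open>\<Sum> c\<^sub>i f\<^sub>i \<in> J'\<close>. If \<open>J'\<close> differs from \<open>J\<close> at
  \<open>N\<close>, there is a vector \<open>l\<close>, not zero modulo \<open>N\<close>, with \<open>\<Sum> c\<^sub>i l\<^sub>i \<in> N\<close> for all \<open>c \<in> M\<close>
  (\<open>dual_vector_or_unit\<close>). An arc is a homomorphism to a polynomial ring in a parameter \<open>t\<close>. If along
  some arc through \<open>N\<close> the gradient has, up to a factor, the leading coefficients \<open>l\<close>, then all of \<open>J'\<close>
  has strictly larger order than \<open>P\<close>, contrary to \<open>P\<^sup>r\<^sup>+\<^sup>1 = J' P\<^sup>r\<close> (\<open>reduction_along_hom\<close>). It remains
  to find such arcs.

  The zero set of \<open>P\<close> is the cone over the rational normal quartic. Away from its vertex a linear arc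
  \<open>x + t v\<close> works: \<open>l\<close> satisfies the syzygies of the gradient, and these cut out the image of the
  Hessian matrix there (\<open>hankel_polar_solvable_0\<close>). At the vertex the arc is \<open>t \<cdot> adj (B t)\<close> for a
  symmetric matrix \<open>B t\<close> whose adjugate is Hankel. As \<open>adj (adj B) = det B \<cdot> B\<close>, the minors along it are
  proportional to the entries of \<open>B t\<close>, and these can be given any starting value on the Pluecker
  quadric (\<open>scaled_adjugate_inverts_minors\<close>, \<open>exists_arc_on_quadric\<close>).\<close>

section \<open>Ideals\<close>

text \<open>For the ring acting on itself this simplification rule moves brackets in products to the left, so
  that it would loop together with \<open>mult.assoc\<close>.\<close>

declare self_module.scale_scale [simp del]

lemmas ideal_0 = self_module.subspace_0
lemmas ideal_add = self_module.subspace_add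
lemmas ideal_scale = self_module.subspace_scale
lemmas ideal_diff = self_module.subspace_diff
lemmas ideal_sum = self_module.subspace_sum

lemma ideal_scale': "is_ideal I \<Longrightarrow> x \<in> I \<Longrightarrow> x * c \<in> I"
  using ideal_scale[of I x c] by (simp add: mult.commute)

lemma is_ideal_ideal_mult: "is_ideal (ideal_mult I J)"
  unfolding ideal_mult_def by (rule self_module.subspace_span)

lemma ideal_mult_memI: "a \<in> I \<Longrightarrow> b \<in> J \<Longrightarrow> a * b \<in> ideal_mult I J"
  unfolding ideal_mult_def by (rule self_module.span_base) auto

lemma ideal_mult_least:
  assumes "is_ideal K" "\<And>a b. a \<in> I \<Longrightarrow> b \<in> J \<Longrightarrow> a * b \<in> K"
  shows "ideal_mult I J \<subseteq> K"
  unfolding ideal_mult_def using assms by (intro self_module.span_minimal) auto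

lemma ideal_mult_mono: "I \<subseteq> I' \<Longrightarrow> J \<subseteq> J' \<Longrightarrow> ideal_mult I J \<subseteq> ideal_mult I' J'"
  by (rule ideal_mult_least[OF is_ideal_ideal_mult]) (auto intro: ideal_mult_memI)

lemma ideal_mult_UNIV:
  assumes "is_ideal I"
  shows "ideal_mult I UNIV = I"
proof
  show "ideal_mult I UNIV \<subseteq> I" using assms by (intro ideal_mult_least) (auto intro: ideal_scale')
  show "I \<subseteq> ideal_mult I UNIV" using ideal_mult_memI[of _ I 1 UNIV] by auto
qed

lemma ideal_power_1: "is_ideal I \<Longrightarrow> ideal_power I (Suc 0) = I"
  by (simp add: ideal_mult_UNIV)

lemma power_mem_ideal_power: "a \<in> I \<Longrightarrow> a ^ n \<in> ideal_power I n"
  by (induction n) (auto intro: ideal_mult_memI)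

text \<open>Modulo \<open>J\<close> every element of \<open>P\<close> is a multiple of \<open>a\<close>, so the square of \<open>a\<close> is the only product of
  generators that needs an argument.\<close>

lemma ideal_mult_span_insert_square:
  assumes J: "is_ideal J" and P: "P = ideal_gen (insert a J)"
    and aa: "a * a \<in> ideal_mult J P"
  shows "ideal_mult P P \<subseteq> ideal_mult J P"
proof (rule ideal_mult_least[OF is_ideal_ideal_mult])
  let ?JP = "ideal_mult J P"
  have aP: "a \<in> P" unfolding P by (auto intro: self_module.span_base)
  have decomp: "\<exists>c. x - c * a \<in> J" if "x \<in> P" for x
    using that by (simp add: P self_module.span_insert self_module.span_eq_iff[THEN iffD2, OF J])
  fix x y assume "x \<in> P" "y \<in> P"
  obtain c where c: "x - c * a \<in> J" using decomp[OF \<open>x \<in> P\<close>] by (rule exE)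
  obtain d where d: "y - d * a \<in> J" using decomp[OF \<open>y \<in> P\<close>] by (rule exE)
  have "x * y = (x - c * a) * y + (c * ((y - d * a) * a) + c * d * (a * a))"
    by (simp add: algebra_simps)
  moreover have "(x - c * a) * y \<in> ?JP" "(y - d * a) * a \<in> ?JP"
    using c d aP \<open>y \<in> P\<close> by (auto intro: ideal_mult_memI)
  ultimately show "x * y \<in> ?JP"
    using aa by (auto intro!: self_module.subspace_add[OF is_ideal_ideal_mult] self_module.subspace_scale[OF
        is_ideal_ideal_mult])
qed

lemma ideal_gen_range:
  fixes f :: "'i::finite \<Rightarrow> 'a::comm_ring_1"
  assumes "p \<in> ideal_gen (range f)"
  obtains c where "p = (\<Sum>i\<in>UNIV. c i * f i)"
proof -
  let ?S = "{p. \<exists>c. p = (\<Sum>i\<in>UNIV. c i * f i)}"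
  have "ideal_gen (range f) \<subseteq> ?S"
  proof (rule self_module.span_minimal)
    show "range f \<subseteq> ?S"
    proof
      fix y assume "y \<in> range f"
      then obtain k where y: "y = f k" by blast
      have "(\<Sum>i\<in>UNIV. (if i = k then 1 else 0) * f i) = (\<Sum>i\<in>UNIV. if i = k then f i else 0)"
        by (intro sum.cong) auto
      then have "y = (\<Sum>i\<in>UNIV. (if i = k then 1 else 0) * f i)" unfolding y by simp
      then show "y \<in> ?S" by (intro CollectI exI[of _ "\<lambda>i. if i = k then 1 else 0"])
    qed
    show "is_ideal ?S"
    proof (rule self_module.subspaceI)
      have "0 = (\<Sum>i\<in>UNIV. 0 * f i)" by simp
      then show "0 \<in> ?S" by (intro CollectI exI[of _ "\<lambda>i. 0"])
    next
      fix x y assume "x \<in> ?S" "y \<in> ?S"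
      then obtain c d where "x = (\<Sum>i\<in>UNIV. c i * f i)" "y = (\<Sum>i\<in>UNIV. d i * f i)" by blast
      then have "x + y = (\<Sum>i\<in>UNIV. (c i + d i) * f i)" by (simp only: sum.distrib distrib_right)
      then show "x + y \<in> ?S" by (intro CollectI exI[of _ "\<lambda>i. c i + d i"])
    next
      fix r x assume "x \<in> ?S"
      then obtain c where "x = (\<Sum>i\<in>UNIV. c i * f i)" by blast
      then have "r * x = (\<Sum>i\<in>UNIV. (r * c i) * f i)" by (simp only: sum_distrib_left mult.assoc)
      then show "r * x \<in> ?S" by (intro CollectI exI[of _ "\<lambda>i. r * c i"])
    qed
  qed
  then show ?thesis using assms that by blast
qed

lemma ideal_gen_insert_range:
  fixes f :: "'i::finite \<Rightarrow> 'a::comm_ring_1"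
  assumes "p \<in> ideal_gen (insert a (range f))"
  obtains r c where "p = r * a + (\<Sum>i\<in>UNIV. c i * f i)"
proof -
  obtain r where "p - r * a \<in> ideal_gen (range f)"
    using assms unfolding self_module.span_insert by blast
  then obtain c where "p - r * a = (\<Sum>i\<in>UNIV. c i * f i)" by (rule ideal_gen_range)
  then have "p = r * a + (\<Sum>i\<in>UNIV. c i * f i)" by (simp add: diff_eq_eq add.commute)
  then show ?thesis by (rule that)
qed

definition prime_ideal :: "'a::comm_ring_1 set \<Rightarrow> bool" where
  "prime_ideal N \<longleftrightarrow> is_ideal N \<and> 1 \<notin> N \<and> (\<forall>x y. x * y \<in> N \<longrightarrow> x \<in> N \<or> y \<in> N)"

lemma prime_ideal_power: "prime_ideal N \<Longrightarrow> x ^ n \<in> N \<Longrightarrow> x \<in> N"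
  by (induction n) (auto simp: prime_ideal_def)

text \<open>An ideal that is maximal among the proper ideals containing \<open>A\<close> is prime, because every element
  outside it is a unit modulo it.\<close>

lemma exists_prime_ideal_above:
  fixes A :: "'a::comm_ring_1 set"
  assumes A: "is_ideal A" "1 \<notin> A"
  obtains N where "prime_ideal N" "A \<subseteq> N"
proof -
  define F where "F = {I. is_ideal I \<and> A \<subseteq> I \<and> 1 \<notin> I}"
  have "\<exists>N\<in>F. \<forall>I\<in>F. N \<subseteq> I \<longrightarrow> I = N"
  proof (rule subset_Zorn_nonempty)
    show "F \<noteq> {}" using A by (auto simp: F_def)
    fix C assume C: "C \<noteq> {}" "subset.chain F C"
    have "is_ideal (\<Union>C)"
    proof (rule self_module.subspaceI)
      obtain I where "I \<in> C" "is_ideal I" using C by (auto simp: subset_chain_def F_def)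
      then show "0 \<in> \<Union>C" using ideal_0[OF \<open>is_ideal I\<close>] by blast
    next
      fix x y assume "x \<in> \<Union>C" "y \<in> \<Union>C"
      then obtain I I' where I: "x \<in> I" "I \<in> C" "y \<in> I'" "I' \<in> C" by auto
      then have "I \<subseteq> I' \<or> I' \<subseteq> I" using C by (auto simp: subset_chain_def)
      moreover have "is_ideal I" "is_ideal I'" using I C by (auto simp: subset_chain_def F_def)
      ultimately have "x + y \<in> I \<or> x + y \<in> I'"
        using I ideal_add[of I x y] ideal_add[of I' x y] by auto
      then show "x + y \<in> \<Union>C" using I by blast
    next
      fix c x assume "x \<in> \<Union>C"
      then obtain I where I: "x \<in> I" "I \<in> C" by blast
      then have "is_ideal I" using C by (auto simp: subset_chain_def F_def)
      then have "c * x \<in> I" using I(1) by (rule ideal_scale)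
      then show "c * x \<in> \<Union>C" using I(2) by blast
    qed
    then show "\<Union>C \<in> F" using C by (auto simp: F_def subset_chain_def)
  qed
  then obtain N where N: "is_ideal N" "A \<subseteq> N" "1 \<notin> N"
    and max: "\<And>I. is_ideal I \<Longrightarrow> A \<subseteq> I \<Longrightarrow> 1 \<notin> I \<Longrightarrow> N \<subseteq> I \<Longrightarrow> I = N"
    by (auto simp: F_def)
  have unit_mod: "\<exists>c. 1 - c * x \<in> N" if "x \<notin> N" for x
  proof -
    have "N \<subseteq> ideal_gen (insert x N)" by (auto intro: self_module.span_base)
    then have "1 \<in> ideal_gen (insert x N)"
      using max[of "ideal_gen (insert x N)"] N(2) that self_module.span_base[of x "insert x N"]
        self_module.subspace_span by auto
    then show ?thesis by (simp add: self_module.span_insert self_module.span_eq_iff[THEN iffD2, OF N(1)])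
  qed
  have "x \<in> N" if xy: "x * y \<in> N" "y \<notin> N" for x y
  proof -
    obtain c where c: "1 - c * y \<in> N" using unit_mod[OF xy(2)] by blast
    have "x * (1 - c * y) + c * (x * y) \<in> N"
      by (rule ideal_add[OF N(1) ideal_scale[OF N(1) c] ideal_scale[OF N(1) xy(1)]])
    then show "x \<in> N" by (simp add: algebra_simps)
  qed
  then have "prime_ideal N" using N by (auto simp: prime_ideal_def)
  then show ?thesis using that N(2) by blast
qed

section \<open>Linear algebra at a prime ideal\<close>

text \<open>This is Gaussian elimination over the local ring at \<open>N\<close>. A submodule \<open>M\<close> of a free module either
  becomes the whole module after localisation, with the single denominator \<open>s\<close>, or it is killed modulo
  \<open>N\<close> by a linear form \<open>l\<close> that is not zero modulo \<open>N\<close>. The vectors are functions with support in \<open>I\<close>,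
  so that an induction on \<open>I\<close> can drop one coordinate: a vector with a unit in the coordinate \<open>k\<close> serves
  as a pivot.\<close>

lemma dual_vector_or_unit:
  fixes M :: "('i \<Rightarrow> 'a::comm_ring_1) set"
  assumes N: "prime_ideal N" and "finite I"
    and add: "\<And>c d. c \<in> M \<Longrightarrow> d \<in> M \<Longrightarrow> (\<lambda>i. c i + d i) \<in> M"
    and scale: "\<And>r c. c \<in> M \<Longrightarrow> (\<lambda>i. r * c i) \<in> M"
    and zero: "(\<lambda>i. 0) \<in> M"
  shows "(\<exists>s. s \<notin> N \<and> (\<forall>d. (\<forall>i. i \<notin> I \<longrightarrow> d i = 0) \<longrightarrow> (\<lambda>i. s * d i) \<in> M)) \<or>
    (\<exists>l. (\<exists>i\<in>I. l i \<notin> N) \<and> (\<forall>c\<in>M. (\<forall>i. i \<notin> I \<longrightarrow> c i = 0) \<longrightarrow> (\<Sum>i\<in>I. c i * l i) \<in> N))"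
  using \<open>finite I\<close>
proof (induction I rule: finite_induct)
  case empty
  have "1 \<notin> N" using N by (simp add: prime_ideal_def)
  moreover have "(\<lambda>i. 1 * d i) \<in> M" if "\<forall>i. i \<notin> {} \<longrightarrow> d i = 0" for d
  proof -
    have "d = (\<lambda>i. 0)" using that by auto
    then show ?thesis using zero by simp
  qed
  ultimately show ?case by blast
next
  case (insert k I)
  have idN: "is_ideal N" and prN: "\<And>x y. x * y \<in> N \<Longrightarrow> x \<in> N \<or> y \<in> N" and oneN: "1 \<notin> N"
    using N by (auto simp: prime_ideal_def)
  show ?case
  proof (cases "\<forall>c\<in>M. (\<forall>i. i \<notin> insert k I \<longrightarrow> c i = 0) \<longrightarrow> c k \<in> N")
    case True
    define l :: "'i \<Rightarrow> 'a" where "l i = (if i = k then 1 else 0)" for i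
    have "(\<Sum>i\<in>insert k I. c i * l i) = c k" for c
    proof -
      have "(\<Sum>i\<in>I. c i * l i) = 0" using insert(2) by (intro sum.neutral) (auto simp: l_def)
      then show ?thesis using insert by (simp add: l_def)
    qed
    moreover have "l k \<notin> N" using oneN by (simp add: l_def)
    ultimately show ?thesis using True by (intro disjI2 exI[of _ l]) auto
  next
    case False
    then obtain w where w: "w \<in> M" "\<And>i. i \<notin> insert k I \<Longrightarrow> w i = 0" "w k \<notin> N" by blast
    from insert.IH show ?thesis
    proof (elim disjE exE conjE)
      fix s assume s: "s \<notin> N" "\<forall>d. (\<forall>i. i \<notin> I \<longrightarrow> d i = 0) \<longrightarrow> (\<lambda>i. s * d i) \<in> M"
      have "(\<lambda>i. s * w k * d i) \<in> M" if d: "\<forall>i. i \<notin> insert k I \<longrightarrow> d i = 0" for d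
      proof -
        \<comment> \<open>The pivot \<open>w\<close> clears the coordinate \<open>k\<close>.\<close>
        have "w k * d i - d k * w i = 0" if "i \<notin> I" for i
          using that d w(2) by (cases "i = k") (auto simp: mult.commute)
        then have *: "(\<lambda>i. s * (w k * d i - d k * w i)) \<in> M"
          using s(2)[rule_format, of "\<lambda>i. w k * d i - d k * w i"] by simp
        have "s * (w k * d i - d k * w i) + s * d k * w i = s * w k * d i" for i
          by (simp add: algebra_simps)
        then show ?thesis
          using add[OF * scale[OF w(1), of "s * d k"]] by simp
      qed
      moreover have "s * w k \<notin> N" using s(1) w(3) prN by blast
      ultimately show ?thesis by blast
    next
      fix l assume l: "\<exists>i\<in>I. l i \<notin> N" "\<forall>c\<in>M. (\<forall>i. i \<notin> I \<longrightarrow> c i = 0) \<longrightarrow> (\<Sum>i\<in>I. c i * l i) \<in> N"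
      \<comment> \<open>The value at \<open>k\<close> makes the form vanish on the pivot \<open>w\<close>.\<close>
      define l' where "l' i = (if i = k then - (\<Sum>j\<in>I. w j * l j) else w k * l i)" for i
      have "(\<Sum>i\<in>insert k I. c i * l' i) \<in> N" if c: "c \<in> M" "\<forall>i. i \<notin> insert k I \<longrightarrow> c i = 0" for c
      proof -
        have "w k * c i + - c k * w i = 0" if "i \<notin> I" for i
          using that c(2) w(2) by (cases "i = k") (auto simp: mult.commute)
        then have *: "(\<Sum>i\<in>I. (w k * c i + - c k * w i) * l i) \<in> N"
          using l(2)[rule_format, OF add[OF scale[OF c(1), of "w k"] scale[OF w(1), of "- c k"]]] by blast
        have "(\<Sum>i\<in>I. c i * l' i) = (\<Sum>i\<in>I. c i * (w k * l i))"
          using insert(2) by (intro sum.cong) (auto simp: l'_def)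
        moreover have "(\<Sum>i\<in>I. (w k * c i + - c k * w i) * l i)
            = (\<Sum>i\<in>I. c i * (w k * l i)) - c k * (\<Sum>j\<in>I. w j * l j)"
          unfolding sum_distrib_left sum_subtractf[symmetric]
          by (rule sum.cong) (simp_all add: algebra_simps)
        ultimately have "(\<Sum>i\<in>insert k I. c i * l' i) = (\<Sum>i\<in>I. (w k * c i + - c k * w i) * l i)"
          using insert by (simp add: l'_def algebra_simps)
        then show ?thesis using * by simp
      qed
      moreover have "\<exists>i\<in>insert k I. l' i \<notin> N"
      proof -
        obtain i where i: "i \<in> I" "l i \<notin> N" using l(1) by blast
        then have "l' i = w k * l i" using insert(2) by (auto simp: l'_def)
        then have "l' i \<notin> N" using i(2) w(3) prN by auto
        then show ?thesis using i(1) by blast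
      qed
      ultimately show ?thesis by blast
    qed
  qed
qed

lemma dual_vector_cases:
  fixes M :: "('i::finite \<Rightarrow> 'a::comm_ring_1) set"
  assumes N: "prime_ideal N"
    and add: "\<And>c d. c \<in> M \<Longrightarrow> d \<in> M \<Longrightarrow> (\<lambda>i. c i + d i) \<in> M"
    and scale: "\<And>r c. c \<in> M \<Longrightarrow> (\<lambda>i. r * c i) \<in> M"
    and zero: "(\<lambda>i. 0) \<in> M"
  obtains s where "s \<notin> N" "\<And>d. (\<lambda>i. s * d i) \<in> M"
    | l k where "l k \<notin> N" "\<And>c. c \<in> M \<Longrightarrow> (\<Sum>i\<in>UNIV. c i * l i) \<in> N"
proof -
  have "(\<exists>s. s \<notin> N \<and> (\<forall>d. (\<forall>i. i \<notin> UNIV \<longrightarrow> d i = 0) \<longrightarrow> (\<lambda>i. s * d i) \<in> M)) \<or>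
    (\<exists>l. (\<exists>i\<in>UNIV. l i \<notin> N) \<and> (\<forall>c\<in>M. (\<forall>i. i \<notin> UNIV \<longrightarrow> c i = 0) \<longrightarrow> (\<Sum>i\<in>UNIV. c i * l i) \<in> N))"
    using N finite_class.finite_UNIV add scale zero by (rule dual_vector_or_unit)
  then show ?thesis using that(1) that(2) by (elim disjE exE conjE bexE) simp_all
qed

section \<open>Reductions along ring homomorphisms\<close>

text \<open>This replaces the valuative criterion for integral dependence. Suppose that \<open>\<phi>\<close> sends \<open>P\<close> into the
  multiples of \<open>d\<close>, up to \<open>N\<close>. If \<open>J\<close> even goes into the multiples of \<open>d\<close> by elements of \<open>N'\<close>, then the
  products in \<open>J P\<^sup>r\<close> go into \<open>d\<^sup>r\<^sup>+\<^sup>1 N'\<close>, and comparison with the power of a single element of \<open>P\<close>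
  shows that \<open>P\<close> goes into \<open>d N'\<close> as well. In the applications the target is a polynomial ring in a
  parameter \<open>t\<close> and \<open>N'\<close> says that the value at \<open>t = 0\<close> vanishes, possibly modulo a prime ideal: if the
  order of \<open>J\<close> along the arc \<open>\<phi>\<close> is larger than that of \<open>d\<close>, then so is the order of \<open>P\<close>.\<close>

lemma reduction_along_hom:
  fixes \<phi> :: "'a::comm_ring_1 \<Rightarrow> 's::comm_ring_1"
  assumes "comm_ring_hom \<phi>"
    and N: "is_ideal N" and regular: "\<And>y. d * y \<in> N \<Longrightarrow> y \<in> N"
    and N': "is_ideal N'" "N \<subseteq> N'" and radical: "\<And>y n. y ^ n \<in> N' \<Longrightarrow> y \<in> N'"
    and P: "\<And>p. p \<in> P \<Longrightarrow> \<exists>h. \<phi> p - d * h \<in> N"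
    and J: "\<And>j. j \<in> J \<Longrightarrow> \<exists>h\<in>N'. \<phi> j - d * h \<in> N"
    and red: "ideal_power P (Suc r) \<subseteq> ideal_mult J (ideal_power P r)"
    and p: "p \<in> P" "\<phi> p - d * h \<in> N"
  shows "h \<in> N'"
proof -
  interpret comm_ring_hom \<phi> by fact
  have mult: "u * v - (b * x) * (e * y) \<in> N" if "u - b * x \<in> N" "v - e * y \<in> N" for u v b e x y :: 's
  proof -
    have "u * v - (b * x) * (e * y) = v * (u - b * x) + b * x * (v - e * y)" by (simp add: algebra_simps)
    then show ?thesis using ideal_add[OF N ideal_scale[OF N that(1)] ideal_scale[OF N that(2)]] by simp
  qed
  have pow: "\<exists>h. \<phi> q - d ^ n * h \<in> N" if "q \<in> ideal_power P n" for q n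
    using that
  proof (induction n arbitrary: q)
    case 0
    then show ?case using ideal_0[OF N] by (auto intro: exI[of _ "\<phi> q"])
  next
    case (Suc n)
    have "ideal_power P (Suc n) \<subseteq> {q. \<exists>h. \<phi> q - d ^ Suc n * h \<in> N}"
      unfolding ideal_power.simps
    proof (rule ideal_mult_least)
      show "is_ideal {q. \<exists>h. \<phi> q - d ^ Suc n * h \<in> N}"
      proof (rule self_module.subspaceI)
        show "0 \<in> {q. \<exists>h. \<phi> q - d ^ Suc n * h \<in> N}" using ideal_0[OF N] by (auto intro: exI[of _ 0])
      next
        fix x y assume "x \<in> {q. \<exists>h. \<phi> q - d ^ Suc n * h \<in> N}" "y \<in> {q. \<exists>h. \<phi> q - d ^ Suc n * h \<in> N}"
        then obtain h k where "\<phi> x - d ^ Suc n * h \<in> N" "\<phi> y - d ^ Suc n * k \<in> N" by auto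
        from ideal_add[OF N this] show "x + y \<in> {q. \<exists>h. \<phi> q - d ^ Suc n * h \<in> N}"
          by (auto simp: hom_add algebra_simps intro!: exI[of _ "h + k"])
      next
        fix c x assume "x \<in> {q. \<exists>h. \<phi> q - d ^ Suc n * h \<in> N}"
        then obtain h where "\<phi> x - d ^ Suc n * h \<in> N" by auto
        from ideal_scale[OF N this, of "\<phi> c"] show "c * x \<in> {q. \<exists>h. \<phi> q - d ^ Suc n * h \<in> N}"
          by (auto simp: hom_mult algebra_simps intro!: exI[of _ "\<phi> c * h"])
      qed
      fix a b assume "a \<in> P" "b \<in> ideal_power P n"
      then obtain h k where "\<phi> a - d * h \<in> N" "\<phi> b - d ^ n * k \<in> N" using P Suc.IH by blast
      from mult[OF this] show "a * b \<in> {q. \<exists>h. \<phi> q - d ^ Suc n * h \<in> N}"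
        by (auto simp: hom_mult mult_ac intro!: exI[of _ "h * k"])
    qed
    then show ?case using Suc.prems by auto
  qed
  let ?K = "{q. \<exists>h\<in>N'. \<phi> q - d ^ Suc r * h \<in> N}"
  have "ideal_mult J (ideal_power P r) \<subseteq> ?K"
  proof (rule ideal_mult_least)
    show "is_ideal ?K"
    proof (rule self_module.subspaceI)
      show "0 \<in> ?K" using ideal_0[OF N] ideal_0[OF N'(1)] by (auto intro: bexI[of _ 0])
    next
      fix x y assume "x \<in> ?K" "y \<in> ?K"
      then obtain h k where hk: "\<phi> x - d ^ Suc r * h \<in> N" "\<phi> y - d ^ Suc r * k \<in> N" "h \<in> N'" "k \<in> N'" by auto
      from ideal_add[OF N this(1,2)] show "x + y \<in> ?K" using ideal_add[OF N'(1) hk(3,4)]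
        by (auto simp: hom_add algebra_simps intro!: bexI[of _ "h + k"])
    next
      fix c x assume "x \<in> ?K"
      then obtain h where h: "\<phi> x - d ^ Suc r * h \<in> N" "h \<in> N'" by auto
      from ideal_scale[OF N this(1), of "\<phi> c"] show "c * x \<in> ?K" using ideal_scale[OF N'(1) h(2)]
        by (auto simp: hom_mult algebra_simps intro!: bexI[of _ "\<phi> c * h"])
    qed
    fix a b assume "a \<in> J" "b \<in> ideal_power P r"
    then obtain h k where h: "h \<in> N'" "\<phi> a - d * h \<in> N" "\<phi> b - d ^ r * k \<in> N" using J pow by blast
    from mult[OF this(2,3)] show "a * b \<in> ?K" using ideal_scale[OF N'(1) h(1), of k]
      by (auto simp: hom_mult mult_ac intro!: bexI[of _ "k * h"])
  qed
  moreover have "p ^ Suc r \<in> ideal_power P (Suc r)" using p(1) by (rule power_mem_ideal_power)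
  ultimately obtain k where k: "k \<in> N'" "\<phi> (p ^ Suc r) - d ^ Suc r * k \<in> N" using red by auto
  have powers: "\<phi> p ^ n - d ^ n * h ^ n \<in> N" for n
  proof (induction n)
    case 0
    show ?case using ideal_0[OF N] by simp
  next
    case (Suc n)
    from mult[OF p(2) Suc.IH] show ?case by (simp add: mult_ac)
  qed
  have cancel: "d ^ n * y \<in> N \<Longrightarrow> y \<in> N" for n y
    by (induction n) (auto simp: mult.assoc intro: regular)
  have "d ^ Suc r * (h ^ Suc r - k) = (\<phi> (p ^ Suc r) - d ^ Suc r * k) - (\<phi> p ^ Suc r - d ^ Suc r * h ^ Suc r)"
    by (simp only: hom_power right_diff_distrib) simp
  then have "d ^ Suc r * (h ^ Suc r - k) \<in> N"
    using ideal_diff[OF N k(2) powers[of "Suc r"]] by (simp only:)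
  then have "h ^ Suc r - k \<in> N'" using cancel N'(2) by blast
  from ideal_add[OF N'(1) this k(1)] have "h ^ Suc r \<in> N'" by simp
  then show ?thesis by (rule radical)
qed

section \<open>Ring homomorphisms on polynomial rings\<close>

text \<open>Evaluation of a polynomial at the point \<open>\<sigma>\<close>, with coefficients mapped by \<open>\<iota>\<close>. It is a ring
  homomorphism as soon as \<open>\<iota>\<close> is one.\<close>

definition subst :: "('k \<Rightarrow> 's) \<Rightarrow> ('v \<Rightarrow> 's) \<Rightarrow> ('v::finite, 'k::comm_ring_1) mpoly \<Rightarrow> 's::comm_ring_1" where
  "subst \<iota> \<sigma> p = (\<Sum>m\<in>Poly_Mapping.keys p. \<iota> (Poly_Mapping.lookup p m) * (\<Prod>v\<in>UNIV. \<sigma> v ^ Poly_Mapping.lookup m v))"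

lemma mpoly_induct [case_names single add]:
  fixes p :: "'m \<Rightarrow>\<^sub>0 'k::comm_monoid_add"
  assumes "\<And>m c. Q (Poly_Mapping.single m c)" and "\<And>p q. Q p \<Longrightarrow> Q q \<Longrightarrow> Q (p + q)"
  shows "Q p"
proof (induction p rule: update_induct)
  case const
  show ?case using assms(1)[of undefined 0] by simp
next
  case (update f m c)
  have "Poly_Mapping.update m c f = f + Poly_Mapping.single m c"
    using update(1) by (intro poly_mapping_eqI) (auto simp: lookup_update lookup_add lookup_single when_def in_keys_iff)
  then show ?case using assms update by simp
qed

context comm_ring_hom
begin

lemma subst_superset:
  assumes "finite A" "Poly_Mapping.keys p \<subseteq> A"
  shows "subst hom \<sigma> p = (\<Sum>m\<in>A. hom (Poly_Mapping.lookup p m) * (\<Prod>v\<in>UNIV. \<sigma> v ^ Poly_Mapping.lookup m v))"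
  unfolding subst_def using assms by (intro sum.mono_neutral_left) (auto simp: in_keys_iff)

lemma subst_add: "subst hom \<sigma> (p + q) = subst hom \<sigma> p + subst hom \<sigma> q"
proof -
  let ?A = "Poly_Mapping.keys p \<union> Poly_Mapping.keys q"
  have "Poly_Mapping.keys (p + q) \<subseteq> ?A" by (rule keys_add)
  then show ?thesis
    by (subst (1 2 3) subst_superset[where A = ?A])
      (auto simp: lookup_add hom_add algebra_simps sum.distrib)
qed

lemma subst_single: "subst hom \<sigma> (Poly_Mapping.single m c) = hom c * (\<Prod>v\<in>UNIV. \<sigma> v ^ Poly_Mapping.lookup m v)"
  by (simp add: subst_superset[where A = "{m}"])

lemma subst_Var: "subst hom \<sigma> (Var v) = \<sigma> v"
  by (simp add: Var_def subst_single lookup_single when_def if_distrib[of "\<lambda>n. _ ^ n"] cong: if_cong)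

lemma subst_zero: "subst hom \<sigma> 0 = 0"
  by (simp add: subst_def)

lemma subst_mult: "subst hom \<sigma> (p * q) = subst hom \<sigma> p * subst hom \<sigma> q"
proof (induction p rule: mpoly_induct)
  case (single m c)
  show ?case
  proof (induction q rule: mpoly_induct)
    case (single n d)
    show ?case
      by (simp only: mult_single subst_single hom_mult lookup_add power_add prod.distrib ac_simps)
  qed (simp add: distrib_left subst_add)
qed (simp add: distrib_right subst_add)

lemma comm_ring_hom_subst: "comm_ring_hom (subst hom \<sigma>)"
proof
  show "subst hom \<sigma> 1 = 1"
    unfolding single_one[symmetric] by (simp add: subst_single del: single_one)
qed (simp_all add: subst_add subst_mult subst_zero)

end

abbreviation Const :: "'k::comm_ring_1 \<Rightarrow> ('v, 'k) mpoly" where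
  "Const \<equiv> Poly_Mapping.single 0"

lemma comm_ring_hom_Const: "comm_ring_hom Const"
  by standard (simp_all add: single_add mult_single)

lemma Const_power_Var: "Poly_Mapping.single (Poly_Mapping.single v n) 1 = Var v ^ n"
proof (induction n)
  case (Suc n)
  have "Poly_Mapping.single v (Suc n) = Poly_Mapping.single v 1 + Poly_Mapping.single v n"
    by (simp add: single_add[symmetric])
  then show ?case
    by (simp only: power_Suc Suc[symmetric]) (simp add: Var_def mult_single)
qed simp

lemma single_eq_prod:
  fixes m :: "'v::finite \<Rightarrow>\<^sub>0 nat"
  shows "Poly_Mapping.single m c = Const c * (\<Prod>v\<in>UNIV. Var v ^ Poly_Mapping.lookup m v)"
proof -
  have m: "m = (\<Sum>v\<in>UNIV. Poly_Mapping.single v (Poly_Mapping.lookup m v))"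
    by (intro poly_mapping_eqI) (simp add: lookup_sum lookup_single when_def)
  have prod: "(\<Prod>v\<in>A. Poly_Mapping.single (g v) 1) = (Poly_Mapping.single (\<Sum>v\<in>A. g v) 1 :: ('v,'k::comm_ring_1)
      mpoly)" for A and g :: "'v \<Rightarrow> ('v \<Rightarrow>\<^sub>0 nat)"
    by (induction A rule: infinite_finite_induct) (simp_all add: mult_single)
  show ?thesis
    unfolding Const_power_Var[symmetric] prod m[symmetric] by (simp add: mult_single)
qed

lemma mpoly_ring_induct [case_names Const Var add mult]:
  fixes p :: "('v::finite, 'k::comm_ring_1) mpoly"
  assumes const: "\<And>c. Q (Const c)" and var: "\<And>v. Q (Var v)"
    and add: "\<And>p q. Q p \<Longrightarrow> Q q \<Longrightarrow> Q (p + q)" and mult: "\<And>p q. Q p \<Longrightarrow> Q q \<Longrightarrow> Q (p * q)"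
  shows "Q p"
proof (induction p rule: mpoly_induct)
  case (single m c)
  have one: "Q 1" using const[of 1] by (simp only: single_one)
  have pow: "Q (Var v ^ n)" for v n by (induction n) (simp_all add: one var mult)
  have "Q (\<Prod>v\<in>A. Var v ^ Poly_Mapping.lookup m v)" for A
    by (induction A rule: infinite_finite_induct) (simp_all add: one pow mult)
  then show ?case unfolding single_eq_prod[of m c] by (intro mult const)
qed (rule add)

lemma mpoly_hom_eqI:
  fixes p :: "('v::finite, 'k::comm_ring_1) mpoly"
  assumes "comm_ring_hom \<phi>" "comm_ring_hom \<psi>" "\<And>c. \<phi> (Const c) = \<psi> (Const c)" "\<And>v. \<phi> (Var v) = \<psi> (Var v)"
  shows "\<phi> p = \<psi> p"
proof -
  interpret \<phi>: comm_ring_hom \<phi> by fact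
  interpret \<psi>: comm_ring_hom \<psi> by fact
  show ?thesis
    by (induction p rule: mpoly_ring_induct) (simp_all only: assms(3,4) \<phi>.hom_add \<psi>.hom_add \<phi>.hom_mult \<psi>.hom_mult)
qed

lemma comm_ring_hom_id: "comm_ring_hom (\<lambda>x :: 'a::comm_ring_1. x)"
  by standard simp_all

lemma comm_ring_hom_comp: "comm_ring_hom \<phi> \<Longrightarrow> comm_ring_hom \<psi> \<Longrightarrow> comm_ring_hom (\<lambda>x. \<psi> (\<phi> x))"
proof -
  assume "comm_ring_hom \<phi>" "comm_ring_hom \<psi>"
  interpret \<phi>: comm_ring_hom \<phi> by fact
  interpret \<psi>: comm_ring_hom \<psi> by fact
  show ?thesis
    by standard (simp_all only: \<phi>.hom_add \<psi>.hom_add \<phi>.hom_mult \<psi>.hom_mult \<phi>.hom_zero \<psi>.hom_zero \<phi>.hom_one \<psi>.hom_one)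
qed

lemma comm_ring_hom_poly_at: "comm_ring_hom (\<lambda>p :: 'a::comm_ring_1 poly. poly p s)"
  by standard simp_all

lemma (in comm_ring_hom) subst_Const: "subst hom \<sigma> (Const c) = hom c"
  by (simp add: subst_single)

lemma comm_ring_hom_const_poly: "comm_ring_hom (\<lambda>c :: 'a::comm_ring_1. [:c:])"
  by standard (simp_all add: one_pCons)

definition const_part :: "('v::finite, 'k::comm_ring_1) mpoly \<Rightarrow> 'k" where
  "const_part = subst (\<lambda>c. c) (\<lambda>_. 0)"

lemma comm_ring_hom_const_part: "comm_ring_hom (const_part :: ('v::finite, 'k::comm_ring_1) mpoly \<Rightarrow> 'k)"
  unfolding const_part_def by (rule comm_ring_hom.comm_ring_hom_subst[OF comm_ring_hom_id])

lemma const_part_Const: "const_part (Const c) = c"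
  and const_part_Var: "const_part (Var v) = 0"
  unfolding const_part_def
  by (rule comm_ring_hom.subst_Const[OF comm_ring_hom_id]) (rule comm_ring_hom.subst_Var[OF comm_ring_hom_id])

text \<open>An ideal that contains all variables sees only the constant term of a polynomial.\<close>

lemma diff_const_part_in_ideal:
  fixes p :: "('v::finite, 'k::comm_ring_1) mpoly"
  assumes N: "is_ideal N" and var: "\<And>v. Var v \<in> N"
  shows "p - Const (const_part p) \<in> N"
proof -
  interpret C: comm_ring_hom "Const :: 'k \<Rightarrow> ('v, 'k) mpoly" by (rule comm_ring_hom_Const)
  interpret c: comm_ring_hom "const_part :: ('v, 'k) mpoly \<Rightarrow> 'k" by (rule comm_ring_hom_const_part)
  show ?thesis
  proof (induction p rule: mpoly_ring_induct)
    case (Const c)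
    show ?case using ideal_0[OF N] by (simp add: const_part_Const)
  next
    case (Var v)
    show ?case using var by (simp add: const_part_Var)
  next
    case (add p q)
    have "p + q - Const (const_part (p + q)) = (p - Const (const_part p)) + (q - Const (const_part q))"
      unfolding c.hom_add C.hom_add by (simp only: add_diff_add)
    then show ?case using ideal_add[OF N add] by (simp only:)
  next
    case (mult p q)
    have "p * q - Const (const_part (p * q))
        = q * (p - Const (const_part p)) + Const (const_part p) * (q - Const (const_part q))"
      unfolding c.hom_mult C.hom_mult right_diff_distrib by (simp add: mult.commute)
    then show ?case using ideal_add[OF N ideal_scale[OF N mult(1)] ideal_scale[OF N mult(2)]] by (simp only:)
  qed
qed

lemma Const_inverse_numeral: "Const (1 / numeral n) * (numeral n * p) = (p :: ('v, 'k::field_char_0) mpoly)"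
proof -
  have "Const (1 / numeral n) * numeral n = (Const (1 / numeral n) * Const (numeral n) :: ('v, 'k) mpoly)"
    by (simp only: single_numeral)
  also have "\<dots> = 1" unfolding mult_single by simp
  finally show ?thesis by (simp only: mult.assoc[symmetric]) simp
qed

lemma ideal_cancel_numeral:
  assumes "is_ideal I" "numeral n * p \<in> I"
  shows "p \<in> (I :: ('v, 'k::field_char_0) mpoly set)"
  using ideal_scale[OF assms, of "Const (1 / numeral n)"] by (simp only: Const_inverse_numeral)

section \<open>Partial derivatives\<close>

lemma partial_deriv_superset:
  assumes "finite A" "Poly_Mapping.keys p \<subseteq> A"
  shows "partial_deriv v p = (\<Sum>m\<in>A. Poly_Mapping.single (m - Poly_Mapping.single v 1)
       (of_nat (Poly_Mapping.lookup m v) * Poly_Mapping.lookup p m))"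
  unfolding partial_deriv_def using assms by (intro sum.mono_neutral_left) (auto simp: in_keys_iff)

lemma partial_deriv_add: "partial_deriv v (p + q) = partial_deriv v p + partial_deriv v q"
proof -
  let ?A = "Poly_Mapping.keys p \<union> Poly_Mapping.keys q"
  have "Poly_Mapping.keys (p + q) \<subseteq> ?A" by (rule keys_add)
  then show ?thesis
    by (subst (1 2 3) partial_deriv_superset[where A = ?A])
      (auto simp: lookup_add distrib_left single_add sum.distrib)
qed

lemma partial_deriv_single: "partial_deriv v (Poly_Mapping.single m c) =
    Poly_Mapping.single (m - Poly_Mapping.single v 1) (of_nat (Poly_Mapping.lookup m v) * c)"
  by (simp add: partial_deriv_superset[where A = "{m}"])

lemma partial_deriv_mult: "partial_deriv v (p * q) = partial_deriv v p * q + p * partial_deriv v q"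
proof (induction p rule: mpoly_induct)
  case (single m c)
  show ?case
  proof (induction q rule: mpoly_induct)
    case (single n d)
    \<comment> \<open>Truncated subtraction on exponents does no harm: if \<open>v\<close> does not occur, the coefficient is zero.\<close>
    have shift: "Poly_Mapping.single (k + l - Poly_Mapping.single v 1) (of_nat (Poly_Mapping.lookup k v) * e)
      = Poly_Mapping.single (k - Poly_Mapping.single v 1 + l) (of_nat (Poly_Mapping.lookup k v) * e)"
      for k l :: "'a \<Rightarrow>\<^sub>0 nat" and e :: 'b
    proof (cases "Poly_Mapping.lookup k v = 0")
      case False
      then have "k + l - Poly_Mapping.single v 1 = k - Poly_Mapping.single v 1 + l"
        by (intro poly_mapping_eqI) (auto simp: lookup_add lookup_minus lookup_single when_def)
      then show ?thesis by simp
    qed simp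
    have "partial_deriv v (Poly_Mapping.single m c * Poly_Mapping.single n d)
      = Poly_Mapping.single (m + n - Poly_Mapping.single v 1) (of_nat (Poly_Mapping.lookup m v) * (c * d))
        + Poly_Mapping.single (n + m - Poly_Mapping.single v 1) (of_nat (Poly_Mapping.lookup n v) * (c * d))"
      by (simp only: mult_single partial_deriv_single lookup_add of_nat_add distrib_right single_add
          add.commute[of n m])
    also have "\<dots> = partial_deriv v (Poly_Mapping.single m c) * Poly_Mapping.single n d
        + Poly_Mapping.single m c * partial_deriv v (Poly_Mapping.single n d)"
      by (simp only: shift[of m n] shift[of n m] mult_single partial_deriv_single
          add.commute[of m "n - _"] mult.assoc mult.left_commute[of c])
    finally show ?case .
  qed (simp add: distrib_left partial_deriv_add)
qed (simp add: distrib_right partial_deriv_add)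

lemma partial_deriv_Var: "partial_deriv v (Var w) = (if v = w then 1 else 0)"
  by (auto simp: Var_def partial_deriv_single lookup_single when_def)

lemma partial_deriv_diff: "partial_deriv v (p - q) = partial_deriv v p - partial_deriv v q"
  using partial_deriv_add[of v "p - q" q] by (simp add: algebra_simps)

section \<open>The gradient and the minors of the Hankel matrix\<close>

text \<open>The five partial derivatives of the determinant, as functions of a point \<open>x\<close> of an arbitrary ring,
  so that they can be evaluated along homomorphisms.\<close>

definition hankel_grad :: "(5 \<Rightarrow> 'a::comm_ring_1) \<Rightarrow> 5 \<Rightarrow> 'a" where
  "hankel_grad x i =
     (if i = 0 then x 2 * x 4 - x 3 * x 3
      else if i = 1 then 2 * (x 2 * x 3 - x 1 * x 4)
      else if i = 2 then x 0 * x 4 + 2 * (x 1 * x 3) - 3 * (x 2 * x 2)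
      else if i = 3 then 2 * (x 1 * x 2 - x 0 * x 3)
      else x 0 * x 2 - x 1 * x 1)"

lemma univ_5: "(UNIV :: 5 set) = {0, 1, 2, 3, 4}"
proof -
  have "card {0, 1, 2, 3, 4 :: 5} = CARD(5)" by simp
  then show ?thesis by (metis card_subset_eq finite subset_UNIV)
qed

lemma all_5: "(\<forall>i::5. Q i) \<longleftrightarrow> Q 0 \<and> Q 1 \<and> Q 2 \<and> Q 3 \<and> Q 4"
proof -
  have "(\<forall>i::5. Q i) \<longleftrightarrow> (\<forall>i\<in>{0,1,2,3,4}. Q i)"
    by (metis univ_5 UNIV_I)
  then show ?thesis by simp
qed

lemma sum_5: "(\<Sum>i\<in>(UNIV :: 5 set). g i) = g 0 + g 1 + g 2 + g 3 + (g 4 :: 'a::comm_ring_1)"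
  unfolding univ_5 by (simp add: add_ac)

text \<open>The one minor that has to be added to the partial derivatives to generate all minors: the minor
  \<open>x\<^sub>0 x\<^sub>4 - x\<^sub>2\<^sup>2\<close> is the derivative in \<open>x\<^sub>2\<close> minus twice this one.\<close>

definition central_minor :: "(5 \<Rightarrow> 'a::comm_ring_1) \<Rightarrow> 'a" where
  "central_minor x = x 1 * x 3 - x 2 * x 2"

lemma hankel_grad_simps:
  "hankel_grad x 0 = x 2 * x 4 - x 3 * x 3"
  "hankel_grad x 1 = 2 * (x 2 * x 3 - x 1 * x 4)"
  "hankel_grad x 2 = x 0 * x 4 + 2 * (x 1 * x 3) - 3 * (x 2 * x 2)"
  "hankel_grad x 3 = 2 * (x 1 * x 2 - x 0 * x 3)"
  "hankel_grad x 4 = x 0 * x 2 - x 1 * x 1"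
  by (simp_all add: hankel_grad_def)

lemma (in comm_ring_hom) hom_hankel_grad: "hom (hankel_grad x i) = hankel_grad (\<lambda>i. hom (x i)) i"
  by (simp add: hankel_grad_def hom_distribs)

lemma (in comm_ring_hom) hom_central_minor: "hom (central_minor x) = central_minor (\<lambda>i. hom (x i))"
  by (simp add: central_minor_def hom_distribs)

text \<open>The Pluecker relation between the maximal minors of the matrix with rows \<open>x\<^sub>0, x\<^sub>1, x\<^sub>2, x\<^sub>3\<close> and
  \<open>x\<^sub>1, x\<^sub>2, x\<^sub>3, x\<^sub>4\<close>, rewritten in terms of the partial derivatives. Where 12 is a unit it makes the
  central minor integral over them.\<close>

lemma central_minor_square:
  fixes x :: "5 \<Rightarrow> 'a::idom"
  shows "12 * (central_minor x * central_minor x)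
     = 4 * (hankel_grad x 2 * central_minor x) - hankel_grad x 1 * hankel_grad x 3 + 4 * (hankel_grad x 0 *
         hankel_grad x 4)"
  unfolding hankel_grad_simps central_minor_def by Groebner_Basis.algebra

text \<open>The determinant is an invariant of binary quartic forms. The three relations express that the
  raising operator, the lowering operator and the torus of \<open>sl\<^sub>2\<close> annihilate it.\<close>

lemma hankel_grad_syzygies:
  fixes x :: "5 \<Rightarrow> 'a::idom"
  shows "x 0 * hankel_grad x 1 + 2 * (x 1 * hankel_grad x 2) + 3 * (x 2 * hankel_grad x 3) + 4 * (x 3 *
      hankel_grad x 4) = 0"
  "x 4 * hankel_grad x 3 + 2 * (x 3 * hankel_grad x 2) + 3 * (x 2 * hankel_grad x 1) + 4 * (x 1 * hankel_grad x 0) = 0"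
  "2 * (x 4 * hankel_grad x 4) + x 3 * hankel_grad x 3 - x 1 * hankel_grad x 1 - 2 * (x 0 * hankel_grad x 0) = 0"
  unfolding hankel_grad_simps by Groebner_Basis.algebra+

lemma det_2x2:
  assumes "A \<in> carrier_mat 2 2"
  shows "det A = A $$ (0, 0) * A $$ (1, 1) - A $$ (0, 1) * (A $$ (1, 0) :: 'a::comm_ring_1)"
proof -
  have "mat_delete A 0 j \<in> carrier_mat 1 1" for j using mat_delete_carrier[OF assms] by simp
  note d = det_single[OF this]
  show ?thesis
    using assms unfolding laplace_expansion_row[OF assms, of 0, simplified]
    by (simp add: numeral_2_eq_2 cofactor_def d[unfolded One_nat_def]) (simp add: mat_delete_def)
qed

lemma det_3x3:
  assumes "A \<in> carrier_mat 3 3"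
  shows "det A = A $$ (0, 0) * (A $$ (1, 1) * A $$ (2, 2) - A $$ (1, 2) * A $$ (2, 1))
    - A $$ (0, 1) * (A $$ (1, 0) * A $$ (2, 2) - A $$ (1, 2) * A $$ (2, 0))
    + A $$ (0, 2) * (A $$ (1, 0) * A $$ (2, 1) - A $$ (1, 1) * (A $$ (2, 0) :: 'a::comm_ring_1))"
proof -
  have "mat_delete A 0 j \<in> carrier_mat 2 2" for j using mat_delete_carrier[OF assms] by simp
  note d = det_2x2[OF this]
  have "{..<3} = {0, 1, 2 :: nat}" by auto
  then show ?thesis
    using assms unfolding laplace_expansion_row[OF assms, of 0, simplified]
    by (simp add: cofactor_def d) (simp add: mat_delete_def numeral_2_eq_2[symmetric] right_diff_distrib)
qed

lemma hankel3_index: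
  assumes "i < 3" "j < 3"
  shows "hankel3 $$ (i, j) = Var (of_nat (i + j))"
proof -
  have "i \<in> {0, 1, 2}" "j \<in> {0, 1, 2}" using assms by auto
  then show ?thesis by (auto simp: hankel3_def mat_of_rows_list_def)
qed

lemma hankel3_carrier: "hankel3 \<in> carrier_mat 3 3"
  by (rule carrier_matI) (simp_all add: hankel3_def mat_of_rows_list_def)

lemma partial_deriv_det_hankel3: "partial_deriv i (det hankel3) = (hankel_grad Var i :: (5, 'k::idom) mpoly)"
proof -
  have "det hankel3 = (Var 0 * (Var 2 * Var 4 - Var 3 * Var 3) - Var 1 * (Var 1 * Var 4 - Var 3 * Var 2)
      + Var 2 * (Var 1 * Var 3 - Var 2 * Var 2) :: (5, 'k) mpoly)"
    by (simp add: det_3x3[OF hankel3_carrier] hankel3_index)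
  moreover have "\<forall>i. partial_deriv i (Var 0 * (Var 2 * Var 4 - Var 3 * Var 3)
      - Var 1 * (Var 1 * Var 4 - Var 3 * Var 2) + Var 2 * (Var 1 * Var 3 - Var 2 * Var 2)) = (hankel_grad Var i ::
          (5, 'k) mpoly)"
    unfolding all_5 hankel_grad_simps partial_deriv_add partial_deriv_diff partial_deriv_mult partial_deriv_Var
    by (intro conjI; simp; (Groebner_Basis.algebra)?)
  ultimately show ?thesis by simp
qed

lemma gradient_ideal_hankel3: "gradient_ideal (det (hankel3 :: (5, 'k::idom) mpoly mat)) = ideal_gen (range
    (hankel_grad Var))"
  by (simp add: gradient_ideal_def partial_deriv_det_hankel3)

lemma det_submatrix_2x2:
  assumes I: "a < b" "b < dim_row A" and J: "c < d" "d < dim_col A"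
  shows "det (submatrix A {a, b} {c, d}) = A $$ (a, c) * A $$ (b, d) - A $$ (a, d) * (A $$ (b, c) :: 'a::comm_ring_1)"
proof -
  have pick: "pick {x, y} 0 = x" "pick {x, y} 1 = y" if "x < y" for x y
  proof -
    show p0: "pick {x, y} 0 = x" using that by (auto intro!: Least_equality)
    show "pick {x, y} 1 = y" using that p0 by (auto intro!: Least_equality)
  qed
  have "{i. i < dim_row A \<and> i \<in> {a, b}} = {a, b}" "{i. i < dim_col A \<and> i \<in> {c, d}} = {c, d}"
    using assms by auto
  then have "submatrix A {a, b} {c, d} = mat 2 2 (\<lambda>(i, j). A $$ (pick {a, b} i, pick {c, d} j))"
    unfolding submatrix_def using assms by (simp add: numeral_2_eq_2)
  then show ?thesis
    using pick[OF I(1)] pick[OF J(1)] by (simp add: det_2x2)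
qed

lemma card_2_subset_3:
  assumes "I \<subseteq> {..<3::nat}" "card I = 2"
  obtains a b where "I = {a, b}" "a < b" "b < 3"
proof -
  obtain a b where "I = {a, b}" "a \<noteq> b" using assms(2) by (auto simp: card_2_iff)
  then show ?thesis using assms(1) that[of a b] that[of b a] by (cases "a < b") (auto simp: insert_commute)
qed

lemma minors_2_hankel3:
  "minors 2 (hankel3 :: (5, 'k::comm_ring_1) mpoly mat) =
    {Var (of_nat (a + c)) * Var (of_nat (b + d)) - Var (of_nat (a + d)) * Var (of_nat (b + c)) |
     a b c d. a < b \<and> b < 3 \<and> c < d \<and> d < 3}" (is "minors 2 ?H = ?M")
proof
  have dims: "dim_row ?H = 3" "dim_col ?H = 3" using hankel3_carrier by blast+
  have minor: "det (submatrix ?H {a, b} {c, d})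
      = Var (of_nat (a + c)) * Var (of_nat (b + d)) - Var (of_nat (a + d)) * Var (of_nat (b + c))"
    if "a < b" "b < 3" "c < d" "d < 3" for a b c d
    using that by (subst det_submatrix_2x2) (simp_all add: dims hankel3_index)
  show "minors 2 ?H \<subseteq> ?M"
  proof
    fix p :: "(5, 'k) mpoly" assume "p \<in> minors 2 hankel3"
    then obtain I J where p: "p = det (submatrix ?H I J)"
      and IJ: "I \<subseteq> {..<3}" "card I = 2" "J \<subseteq> {..<3}" "card J = 2"
      unfolding minors_def dims by blast
    obtain a b where I: "I = {a, b}" "a < b" "b < 3" using card_2_subset_3[OF IJ(1,2)] .
    obtain c d where J: "J = {c, d}" "c < d" "d < 3" using card_2_subset_3[OF IJ(3,4)] .
    show "p \<in> ?M" unfolding p I(1) J(1) minor[OF I(2,3) J(2,3)] using I J by blast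
  qed
  show "?M \<subseteq> minors 2 ?H"
  proof
    fix p :: "(5, 'k) mpoly" assume "p \<in> ?M"
    then obtain a b c d where abcd: "a < b" "b < 3" "c < d" "d < 3" and p: "p = det (submatrix ?H {a, b} {c, d})"
      using minor by (smt (verit, best) mem_Collect_eq)
    have "card {a, b} = 2" "card {c, d} = 2" "{a, b} \<subseteq> {..<3}" "{c, d} \<subseteq> {..<3}" using abcd by auto
    then show "p \<in> minors 2 ?H" unfolding p minors_def dims by blast
  qed
qed

text \<open>In characteristic zero the factors 2 in the partial derivatives are units, so each minor is a
  combination of the partial derivatives and the central minor.\<close>

lemma minors_ideal_hankel3:
  "minors_ideal 2 hankel3 = ideal_gen (insert (central_minor Var) (range (hankel_grad Var :: 5 \<Rightarrow> (5,
      'k::field_char_0) mpoly)))"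
    (is "?P = ?Q")
proof
  let ?x = "Var :: 5 \<Rightarrow> (5, 'k) mpoly"
  have Q: "is_ideal ?Q" by (rule self_module.subspace_span)
  have gradQ: "hankel_grad ?x i \<in> ?Q" for i by (rule self_module.span_base) auto
  have centreQ: "central_minor ?x \<in> ?Q" by (rule self_module.span_base) auto
  have m: "?x 1 * ?x 3 - ?x 2 * ?x 2 \<in> ?Q" "?x 2 * ?x 4 - ?x 3 * ?x 3 \<in> ?Q" "?x 0 * ?x 2 - ?x 1 * ?x 1 \<in> ?Q"
    using centreQ gradQ[of 0] gradQ[of 4] unfolding central_minor_def hankel_grad_simps .
  have m1: "?x 2 * ?x 3 - ?x 1 * ?x 4 \<in> ?Q" and m3: "?x 1 * ?x 2 - ?x 0 * ?x 3 \<in> ?Q"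
    using gradQ[of 1] gradQ[of 3] unfolding hankel_grad_simps by (blast intro: ideal_cancel_numeral[OF Q])+
  have "?x 0 * ?x 4 - ?x 2 * ?x 2 = hankel_grad ?x 2 - 2 * central_minor ?x"
    unfolding central_minor_def hankel_grad_simps by Groebner_Basis.algebra
  then have m2: "?x 0 * ?x 4 - ?x 2 * ?x 2 \<in> ?Q"
    using ideal_diff[OF Q gradQ[of 2] ideal_scale[OF Q centreQ, of 2]] by (simp only:)
  have m1': "?x 1 * ?x 4 - ?x 2 * ?x 3 \<in> ?Q" and m3': "?x 0 * ?x 3 - ?x 1 * ?x 2 \<in> ?Q"
    using self_module.subspace_neg[OF Q m1] self_module.subspace_neg[OF Q m3] by simp_all
  have "minors 2 hankel3 \<subseteq> ?Q"
  proof
    fix p :: "(5, 'k) mpoly" assume "p \<in> minors 2 hankel3"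
    then obtain a b c d :: nat
      where p: "p = ?x (of_nat (a + c)) * ?x (of_nat (b + d)) - ?x (of_nat (a + d)) * ?x (of_nat (b + c))"
      and abcd: "a < b" "b < 3" "c < d" "d < 3" unfolding minors_2_hankel3 by blast
    have "(a = 0 \<and> b = 1 \<or> a = 0 \<and> b = 2 \<or> a = 1 \<and> b = 2) \<and> (c = 0 \<and> d = 1 \<or> c = 0 \<and> d = 2 \<or> c = 1 \<and> d = 2)"
      using abcd by linarith
    then show "p \<in> ?Q" unfolding p using m m1 m1' m2 m3 m3'
      by (elim conjE disjE) (simp_all add: mult.commute[of "?x 2" "?x 1"] mult.commute[of "?x 3" "?x 1"]
          mult.commute[of "?x 3" "?x 2"])
  qed
  then show "?P \<subseteq> ?Q" unfolding minors_ideal_def by (rule self_module.span_minimal[OF _ Q])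
  have P: "is_ideal ?P" unfolding minors_ideal_def by (rule self_module.subspace_span)
  have minor: "?x (of_nat (a + c)) * ?x (of_nat (b + d)) - ?x (of_nat (a + d)) * ?x (of_nat (b + c)) \<in> ?P"
    if "a < b" "b < 3" "c < d" "d < 3" for a b c d
    unfolding minors_ideal_def minors_2_hankel3 using that by (intro self_module.span_base) blast
  have n: "?x 1 * ?x 3 - ?x 2 * ?x 2 \<in> ?P" "?x 2 * ?x 4 - ?x 3 * ?x 3 \<in> ?P"
    "?x 1 * ?x 4 - ?x 2 * ?x 3 \<in> ?P" "?x 0 * ?x 4 - ?x 2 * ?x 2 \<in> ?P"
    "?x 0 * ?x 3 - ?x 2 * ?x 1 \<in> ?P" "?x 0 * ?x 2 - ?x 1 * ?x 1 \<in> ?P"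
    using minor[of 0 1 1 2] minor[of 1 2 1 2] minor[of 0 2 1 2] minor[of 0 2 0 2] minor[of 0 1 0 2] minor[of 0 1 0 1]
    by simp_all
  have "hankel_grad ?x 1 = - 2 * (?x 1 * ?x 4 - ?x 2 * ?x 3)" "hankel_grad ?x 3 = - 2 * (?x 0 * ?x 3 - ?x 2 * ?x 1)"
    "hankel_grad ?x 2 = (?x 0 * ?x 4 - ?x 2 * ?x 2) + 2 * (?x 1 * ?x 3 - ?x 2 * ?x 2)"
    unfolding hankel_grad_simps by Groebner_Basis.algebra+
  moreover have "hankel_grad ?x 0 = ?x 2 * ?x 4 - ?x 3 * ?x 3" "hankel_grad ?x 4 = ?x 0 * ?x 2 - ?x 1 * ?x 1"
    by (rule hankel_grad_simps)+
  moreover note n(2,6) ideal_scale[OF P n(3), of "- 2"] ideal_scale[OF P n(5), of "- 2"]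
    ideal_add[OF P n(4) ideal_scale[OF P n(1), of 2]]
  ultimately have "\<forall>i. hankel_grad ?x i \<in> ?P" unfolding all_5 by (simp only:)
  moreover have "central_minor ?x \<in> ?P" unfolding central_minor_def by (rule n(1))
  ultimately show "?Q \<subseteq> ?P" by (intro self_module.span_minimal[OF _ P]) auto
qed

section \<open>Tangent directions away from the vertex\<close>

text \<open>The derivative of the gradient at \<open>x\<close> in the direction \<open>v\<close>, that is, the Hessian matrix at \<open>x\<close>
  applied to \<open>v\<close>. As the gradient is quadratic, its second difference is this bilinear form.\<close>

definition hankel_polar :: "(5 \<Rightarrow> 'a::comm_ring_1) \<Rightarrow> (5 \<Rightarrow> 'a) \<Rightarrow> 5 \<Rightarrow> 'a" where
  "hankel_polar x v i = hankel_grad (\<lambda>j. x j + v j) i - hankel_grad x i - hankel_grad v i"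

lemma hankel_grad_add_scale:
  fixes x v :: "5 \<Rightarrow> 'a::idom"
  shows "hankel_grad (\<lambda>j. x j + t * v j) i = hankel_grad x i + t * hankel_polar x v i + t * t * hankel_grad v i"
proof -
  have "\<forall>i. hankel_grad (\<lambda>j. x j + t * v j) i = hankel_grad x i + t * hankel_polar x v i + t * t * hankel_grad v i"
    unfolding all_5 hankel_polar_def hankel_grad_simps by (intro conjI; Groebner_Basis.algebra)
  then show ?thesis by blast
qed

lemma hankel_grad_pCons:
  fixes x v :: "5 \<Rightarrow> 'a::idom"
  shows "hankel_grad (\<lambda>i. [:x i, v i:]) i = [:hankel_grad x i, hankel_polar x v i, hankel_grad v i:]"
proof -
  interpret c: comm_ring_hom "\<lambda>c :: 'a. [:c:]" by (rule comm_ring_hom_const_poly)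
  have "hankel_grad (\<lambda>i. [:x i, v i:]) i = hankel_grad (\<lambda>i. [:x i:] + [:0, 1:] * [:v i:]) i" by simp
  also have "\<dots> = [:hankel_grad x i:] + [:0, 1:] * [:hankel_polar x v i:] + [:0, 1:] * [:0, 1:] * [:hankel_grad v i:]"
    unfolding hankel_grad_add_scale hankel_polar_def c.hom_hankel_grad c.hom_minus c.hom_add ..
  finally show ?thesis by simp
qed

text \<open>Modulo \<open>N\<close> the point \<open>x\<close> lies on the cone over the rational normal quartic. At such a point a
  vector that satisfies the syzygies of the gradient is in the image of the Hessian matrix, up to the
  factor \<open>4 x\<^sub>0\<^sup>3\<close>. With \<open>v\<^sub>0 = v\<^sub>1 = 0\<close> the coordinates 4, 3 and 2 form a triangular system for \<open>v\<^sub>2\<close>,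
  \<open>v\<^sub>3\<close> and \<open>v\<^sub>4\<close> with multiples of \<open>x\<^sub>0\<close> on the diagonal, and the syzygies then give the coordinates 1
  and 0.\<close>

lemma hankel_polar_solvable_0:
  fixes x l :: "5 \<Rightarrow> 'a::idom"
  assumes N: "is_ideal N" and grad: "\<And>i. hankel_grad x i \<in> N" and centre: "central_minor x \<in> N"
    and syz1: "x 0 * l 1 + 2 * (x 1 * l 2) + 3 * (x 2 * l 3) + 4 * (x 3 * l 4) \<in> N" (is "?s1 \<in> N")
    and syz3: "2 * (x 4 * l 4) + x 3 * l 3 - x 1 * l 1 - 2 * (x 0 * l 0) \<in> N" (is "?s3 \<in> N")
  shows "\<exists>v. \<forall>i. hankel_polar x v i - 4 * x 0 ^ 3 * l i \<in> N"
proof -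
  define v where "v i = (if i = 2 then 4 * x 0 ^ 2 * l 4
      else if i = 3 then 4 * x 0 * x 1 * l 4 - 2 * x 0 ^ 2 * l 3
      else if i = 4 then 4 * x 0 ^ 2 * l 2 + 4 * x 0 * x 1 * l 3 + 24 * x 0 * x 2 * l 4 - 8 * x 1 ^ 2 * l 4
      else 0)" for i :: 5
  have v: "v 0 = 0" "v 1 = 0" "v 2 = 4 * x 0 ^ 2 * l 4" "v 3 = 4 * x 0 * x 1 * l 4 - 2 * x 0 ^ 2 * l 3"
    "v 4 = 4 * x 0 ^ 2 * l 2 + 4 * x 0 * x 1 * l 3 + 24 * x 0 * x 2 * l 4 - 8 * x 1 ^ 2 * l 4"
    by (simp_all add: v_def)
  have "hankel_polar x v 4 - 4 * x 0 ^ 3 * l 4 = 0" "hankel_polar x v 3 - 4 * x 0 ^ 3 * l 3 = 0"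
    "hankel_polar x v 2 - 4 * x 0 ^ 3 * l 2 = 0"
    unfolding hankel_polar_def hankel_grad_simps v by Groebner_Basis.algebra+
  then have v234: "hankel_polar x v 4 - 4 * x 0 ^ 3 * l 4 \<in> N" "hankel_polar x v 3 - 4 * x 0 ^ 3 * l 3 \<in> N"
    "hankel_polar x v 2 - 4 * x 0 ^ 3 * l 2 \<in> N"
    using ideal_0[OF N] by (simp_all only:)
  \<comment> \<open>The multipliers come from eliminating \<open>l\<^sub>1\<close> and \<open>l\<^sub>0\<close> with the two syzygies.\<close>
  have e1: "hankel_polar x v 1 - 4 * x 0 ^ 3 * l 1
    = - 4 * x 0 ^ 2 * ?s1 + (8 * x 0 * l 3 - 16 * x 1 * l 4) * hankel_grad x 4 - 12 * x 0 * l 4 * hankel_grad x 3"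
    unfolding hankel_polar_def hankel_grad_simps v by Groebner_Basis.algebra
  have v1: "hankel_polar x v 1 - 4 * x 0 ^ 3 * l 1 \<in> N"
    unfolding e1
    by (rule ideal_diff[OF N ideal_add[OF N ideal_scale[OF N syz1] ideal_scale[OF N grad]] ideal_scale[OF N grad]])
  have e0: "hankel_polar x v 0 - 4 * x 0 ^ 3 * l 0
    = 2 * x 0 ^ 2 * ?s3 + 2 * x 0 * x 1 * ?s1 + (4 * x 0 * l 2 + 8 * x 2 * l 4) * hankel_grad x 4
      - x 0 * l 3 * hankel_grad x 3 - 16 * x 0 * l 4 * central_minor x"
    unfolding hankel_polar_def hankel_grad_simps central_minor_def v by Groebner_Basis.algebra
  have v0: "hankel_polar x v 0 - 4 * x 0 ^ 3 * l 0 \<in> N"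
    unfolding e0
    by (rule ideal_diff[OF N ideal_diff[OF N ideal_add[OF N ideal_add[OF N ideal_scale[OF N syz3]
          ideal_scale[OF N syz1]] ideal_scale[OF N grad]] ideal_scale[OF N grad]] ideal_scale[OF N centre]])
  have "\<forall>i. hankel_polar x v i - 4 * x 0 ^ 3 * l i \<in> N"
    unfolding all_5 using v0 v1 v234 by (intro conjI)
  then show ?thesis by blast
qed

text \<open>Reversing the order of the variables is a symmetry of the Hankel matrix; it carries the chart
  \<open>x\<^sub>0 \<noteq> 0\<close> to the chart \<open>x\<^sub>4 \<noteq> 0\<close>.\<close>

definition opposite :: "5 \<Rightarrow> 5" where
  "opposite i = (if i = 0 then 4 else if i = 1 then 3 else if i = 2 then 2 else if i = 3 then 1 else 0)"

lemma opposite_simps [simp]: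
  "opposite 0 = 4" "opposite 1 = 3" "opposite 2 = 2" "opposite 3 = 1" "opposite 4 = 0"
  by (simp_all add: opposite_def)

lemma opposite_opposite [simp]: "opposite (opposite i) = i"
proof -
  have "\<forall>i. opposite (opposite i) = i" unfolding all_5 by simp
  then show ?thesis by blast
qed

lemma hankel_grad_opposite:
  fixes x :: "5 \<Rightarrow> 'a::idom"
  shows "hankel_grad (\<lambda>j. x (opposite j)) i = hankel_grad x (opposite i)"
proof -
  have "\<forall>i. hankel_grad (\<lambda>j. x (opposite j)) i = hankel_grad x (opposite i)"
    unfolding all_5 opposite_simps hankel_grad_simps by (intro conjI; rule refl | Groebner_Basis.algebra)
  then show ?thesis by blast
qed

lemma central_minor_opposite: "central_minor (\<lambda>j. x (opposite j)) = central_minor x"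
  unfolding central_minor_def opposite_simps mult.commute[of "x 3"] ..

lemma hankel_polar_solvable_4:
  fixes x l :: "5 \<Rightarrow> 'a::idom"
  assumes N: "is_ideal N" and grad: "\<And>i. hankel_grad x i \<in> N" and centre: "central_minor x \<in> N"
    and syz2: "x 4 * l 3 + 2 * (x 3 * l 2) + 3 * (x 2 * l 1) + 4 * (x 1 * l 0) \<in> N"
    and syz3: "2 * (x 4 * l 4) + x 3 * l 3 - x 1 * l 1 - 2 * (x 0 * l 0) \<in> N"
  shows "\<exists>v. \<forall>i. hankel_polar x v i - 4 * x 4 ^ 3 * l i \<in> N"
proof -
  have "2 * (x 0 * l 0) + x 1 * l 1 - x 3 * l 3 - 2 * (x 4 * l 4)
      = - (2 * (x 4 * l 4) + x 3 * l 3 - x 1 * l 1 - 2 * (x 0 * l 0))" by Groebner_Basis.algebra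
  then have "2 * (x 0 * l 0) + x 1 * l 1 - x 3 * l 3 - 2 * (x 4 * l 4) \<in> N"
    using self_module.subspace_neg[OF N syz3] by (simp only:)
  then have "\<exists>v. \<forall>i. hankel_polar (\<lambda>j. x (opposite j)) v i - 4 * x (opposite 0) ^ 3 * l (opposite i) \<in> N"
    using hankel_polar_solvable_0[OF N, of "\<lambda>j. x (opposite j)" "\<lambda>j. l (opposite j)"] grad centre syz2
    unfolding hankel_grad_opposite central_minor_opposite opposite_simps by blast
  then obtain v where v: "\<And>i. hankel_polar (\<lambda>j. x (opposite j)) v i - 4 * x 4 ^ 3 * l (opposite i) \<in> N"
    unfolding opposite_simps by blast
  have "hankel_polar (\<lambda>j. x (opposite j)) v (opposite i) = hankel_polar x (\<lambda>j. v (opposite j)) i" for i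
    using hankel_grad_opposite[of "\<lambda>j. x j + v (opposite j)" "opposite i"] hankel_grad_opposite[of x "opposite i"]
      hankel_grad_opposite[of "\<lambda>j. v (opposite j)" "opposite i"]
    by (simp add: hankel_polar_def)
  then have "hankel_polar x (\<lambda>j. v (opposite j)) i - 4 * x 4 ^ 3 * l i \<in> N" for i
    using v[of "opposite i"] by simp
  then show ?thesis by blast
qed

section \<open>Arcs through the vertex\<close>

text \<open>The minors of a Hankel matrix are the entries of its adjugate, so values \<open>b\<close> of the gradient and
  \<open>a\<close> of the central minor correspond to the symmetric matrix \<open>B\<close> with diagonal \<open>b\<^sub>0, b\<^sub>2 - 2 a, b\<^sub>4\<close>
  and the entries \<open>b\<^sub>1 / 2\<close>, \<open>a\<close>, \<open>b\<^sub>3 / 2\<close> above it. The following are the entries of four times the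
  adjugate of \<open>B\<close>, where the entry number 2 is the one in the upper right corner.\<close>

definition scaled_adjugate :: "(5 \<Rightarrow> 'a::comm_ring_1) \<Rightarrow> 'a \<Rightarrow> 5 \<Rightarrow> 'a" where
  "scaled_adjugate b a i =
     (if i = 0 then 4 * ((b 2 - 2 * a) * b 4) - b 3 * b 3
      else if i = 1 then 2 * (a * b 3) - 2 * (b 1 * b 4)
      else if i = 2 then b 1 * b 3 - 4 * (a * (b 2 - 2 * a))
      else if i = 3 then 2 * (a * b 1) - 2 * (b 0 * b 3)
      else 4 * (b 0 * (b 2 - 2 * a)) - b 1 * b 1)"

text \<open>Four times the determinant of the same symmetric matrix.\<close>

definition scaled_det :: "(5 \<Rightarrow> 'a::comm_ring_1) \<Rightarrow> 'a \<Rightarrow> 'a" where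
  "scaled_det b a = 4 * (b 0 * b 4 * (b 2 - 2 * a)) - b 0 * (b 3 * b 3) - b 1 * b 1 * b 4
     + 2 * (a * b 1 * b 3) - 4 * (a * a * (b 2 - 2 * a))"

lemma scaled_adjugate_simps:
  "scaled_adjugate b a 0 = 4 * ((b 2 - 2 * a) * b 4) - b 3 * b 3"
  "scaled_adjugate b a 1 = 2 * (a * b 3) - 2 * (b 1 * b 4)"
  "scaled_adjugate b a 2 = b 1 * b 3 - 4 * (a * (b 2 - 2 * a))"
  "scaled_adjugate b a 3 = 2 * (a * b 1) - 2 * (b 0 * b 3)"
  "scaled_adjugate b a 4 = 4 * (b 0 * (b 2 - 2 * a)) - b 1 * b 1"
  by (simp_all add: scaled_adjugate_def)

text \<open>The Pluecker relation for \<open>(b, a)\<close> says that the adjugate of \<open>B\<close> is a Hankel matrix: its corner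
  entry equals its central one. The minors of that Hankel matrix are the entries of
  \<open>adj (adj B) = det B \<cdot> B\<close>, so up to a common factor the gradient map takes it back to \<open>b\<close>.\<close>

lemma scaled_adjugate_inverts_minors:
  fixes b :: "5 \<Rightarrow> 'a::idom"
  assumes "12 * (a * a) = 4 * (b 2 * a) - b 1 * b 3 + 4 * (b 0 * b 4)"
  shows "hankel_grad (scaled_adjugate b a) i = 4 * scaled_det b a * b i"
    and "central_minor (scaled_adjugate b a) = 4 * scaled_det b a * a"
proof -
  \<comment> \<open>The corner entry of the adjugate, rewritten as its central entry.\<close>
  have mid: "scaled_adjugate b a 2 = 4 * (b 0 * b 4 - a * a)"
    unfolding scaled_adjugate_simps using assms by Groebner_Basis.algebra
  have centre: "scaled_adjugate b a 1 * scaled_adjugate b a 3 - scaled_adjugate b a 2 * scaled_adjugate b a 2 = 4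
      * scaled_det b a * a"
    by (subst mid) (unfold scaled_adjugate_simps scaled_det_def, Groebner_Basis.algebra)
  have "hankel_grad (scaled_adjugate b a) 0 = 4 * scaled_det b a * b 0" "hankel_grad (scaled_adjugate b a) 4 = 4 *
      scaled_det b a * b 4"
    unfolding hankel_grad_simps mid unfolding scaled_adjugate_simps scaled_det_def by Groebner_Basis.algebra+
  moreover have "hankel_grad (scaled_adjugate b a) 1 = 4 * scaled_det b a * b 1" "hankel_grad (scaled_adjugate b
      a) 3 = 4 * scaled_det b a * b 3"
    unfolding hankel_grad_simps scaled_adjugate_simps scaled_det_def by Groebner_Basis.algebra+
  moreover have "scaled_adjugate b a 0 * scaled_adjugate b a 4 - scaled_adjugate b a 2 * scaled_adjugate b a 2 = 4
      * scaled_det b a * (b 2 - 2 * a)"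
    unfolding scaled_adjugate_simps scaled_det_def by Groebner_Basis.algebra
  then have "hankel_grad (scaled_adjugate b a) 2 = 4 * scaled_det b a * b 2"
    using centre unfolding hankel_grad_simps by Groebner_Basis.algebra
  ultimately have "\<forall>i. hankel_grad (scaled_adjugate b a) i = 4 * scaled_det b a * b i"
    unfolding all_5 by (intro conjI)
  then show "hankel_grad (scaled_adjugate b a) i = 4 * scaled_det b a * b i" by blast
  show "central_minor (scaled_adjugate b a) = 4 * scaled_det b a * a" unfolding central_minor_def by (rule centre)
qed

text \<open>Along the two kinds of arcs used below, four times the determinant is \<open>- 4 a\<^sup>3\<close> plus terms of
  lower degree in the parameter, so its top coefficient is known.\<close>

lemma coeff_det_arc_fixed_ends:
  fixes l0 l1 l3 l4 \<alpha> :: "'k::field"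
  defines "a \<equiv> [:\<alpha>, 1:]"
  shows "Polynomial.coeff (- 4 * (a * (a * a)) + (4 * ([:l0:] * [:l4:]) + 2 * ([:l1:] * [:l3:])) * a
      - ([:l0:] * ([:l3:] * [:l3:]) + [:l1:] * [:l1:] * [:l4:])) 3 = - 4"
  by (simp add: a_def numeral_poly eval_nat_numeral)

lemma coeff_det_arc_moving_ends:
  fixes l0 l1 l3 l4 \<alpha> e :: "'k::field"
  defines "a \<equiv> [:\<alpha>, l0 + l4, e:]"
  shows "Polynomial.coeff (4 * ([:l0, e:] * [:l4, e:]) * (a - [:e:]) - [:l0, e:] * ([:l3:] * [:l3:])
      - [:l1:] * [:l1:] * [:l4, e:] + 2 * (a * [:l1:] * [:l3:]) - 4 * (a * (a * a)) + 4 * (a * (a * [:e:]))) 6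
    = - 4 * (e * (e * e))"
  by (simp add: a_def numeral_poly eval_nat_numeral)

lemma quadric_arc_moving_ends:
  fixes l0 l1 l3 l4 \<alpha> e :: "'k::field"
  assumes "4 * (e * \<alpha>) = 4 * (l0 * l4) - l1 * l3"
  shows "4 * ([:e:] * [:\<alpha>, l0 + l4, e:]) = 4 * ([:l0, e:] * [:l4, e:]) - [:l1:] * [:l3:]"
proof -
  have "e * \<alpha> * 4 = 4 * (l0 * l4) - l1 * l3" using assms by (simp only: mult.commute[of _ 4])
  then show ?thesis by (simp add: numeral_poly distrib_left mult.commute)
qed

text \<open>Every value \<open>l\<close> of the gradient is completed by a root \<open>\<alpha>\<close> of a quadratic equation to a point
  \<open>(l, \<alpha>)\<close> on the Pluecker quadric; this is where an algebraically closed field is used. An arc on the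
  quadric starts at this point and does not stay in the locus \<open>det B = 0\<close>. In terms of \<open>e = 3 \<alpha> - l\<^sub>2\<close>
  the quadric is \<open>4 e \<alpha> = 4 l\<^sub>0 l\<^sub>4 - l\<^sub>1 l\<^sub>3\<close>. If \<open>e = 0\<close>, then \<open>\<alpha>\<close> and \<open>l\<^sub>2\<close> can be moved together,
  keeping \<open>e = 0\<close>. Otherwise \<open>l\<^sub>0\<close> and \<open>l\<^sub>4\<close> are moved with speed \<open>e\<close>, which lets \<open>\<alpha>\<close> follow without a
  division, and \<open>l\<^sub>2\<close> is adjusted to keep \<open>e\<close> constant.\<close>

lemma exists_arc_on_quadric:
  fixes l :: "5 \<Rightarrow> 'k::{alg_closed_field, field_char_0}"
  obtains b :: "5 \<Rightarrow> 'k poly" and a :: "'k poly"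
    where "\<And>i. poly (b i) 0 = l i"
      and "12 * (a * a) = 4 * (b 2 * a) - b 1 * b 3 + 4 * (b 0 * b 4)"
      and "scaled_det b a \<noteq> 0"
proof -
  interpret c: comm_ring_hom "\<lambda>c :: 'k. [:c:]" by (rule comm_ring_hom_const_poly)
  let ?q = "[: l 1 * l 3 - 4 * (l 0 * l 4), - 4 * l 2, 12 :]"
  have "Polynomial.degree ?q > 0" by simp
  then obtain \<alpha> where "poly ?q \<alpha> = 0"
    using alg_closed_imp_poly_has_root by blast
  then have "l 1 * l 3 - 4 * (l 0 * l 4) + \<alpha> * (- 4 * l 2 + \<alpha> * 12) = 0"
    by (simp only: poly_pCons poly_0 mult_zero_right add_0_right)
  then have \<alpha>: "12 * (\<alpha> * \<alpha>) = 4 * (l 2 * \<alpha>) - l 1 * l 3 + 4 * (l 0 * l 4)"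
    by Groebner_Basis.algebra
  show ?thesis
  proof (cases "l 2 = 3 * \<alpha>")
    case True
    define a where "a = [:\<alpha>, 1:]"
    define b where "b i = (if i = 2 then 3 * a else [:l i:])" for i
    have b: "b 0 = [:l 0:]" "b 1 = [:l 1:]" "b 2 = 3 * a" "b 3 = [:l 3:]" "b 4 = [:l 4:]"
      by (simp_all add: b_def)
    have "scaled_det b a = - 4 * (a * (a * a)) + (4 * ([:l 0:] * [:l 4:]) + 2 * ([:l 1:] * [:l 3:])) * a
        - ([:l 0:] * ([:l 3:] * [:l 3:]) + [:l 1:] * [:l 1:] * [:l 4:])"
      unfolding scaled_det_def b by Groebner_Basis.algebra
    also have "Polynomial.coeff \<dots> 3 = - 4" unfolding a_def by (rule coeff_det_arc_fixed_ends)
    finally have "scaled_det b a \<noteq> 0" by auto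
    moreover have "4 * (l 0 * l 4) = l 1 * l 3" using \<alpha> True by Groebner_Basis.algebra
    then have "[:4:] * ([:l 0:] * [:l 4:]) = [:l 1:] * [:l 3:]" by (simp only: c.hom_mult[symmetric])
    then have "12 * (a * a) = 4 * (b 2 * a) - b 1 * b 3 + 4 * (b 0 * b 4)"
      unfolding b numeral_poly[of "num.Bit0 (num.Bit0 num.One)", symmetric] by Groebner_Basis.algebra
    moreover have "poly (b i) 0 = l i" for i using True by (simp add: b_def a_def)
    ultimately show ?thesis using that by blast
  next
    case False
    define e where "e = 3 * \<alpha> - l 2"
    have "e \<noteq> 0" using False by (simp add: e_def)
    define a where "a = [:\<alpha>, l 0 + l 4, e:]"
    define b where "b i = (if i = 2 then 3 * a - [:e:] else if i = 0 \<or> i = 4 then [:l i, e:] else [:l i:])" for i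
    have b: "b 0 = [:l 0, e:]" "b 1 = [:l 1:]" "b 2 = 3 * a - [:e:]" "b 3 = [:l 3:]" "b 4 = [:l 4, e:]"
      by (simp_all add: b_def)
    have "scaled_det b a = 4 * (b 0 * b 4) * (a - [:e:]) - b 0 * (b 3 * b 3) - b 1 * b 1 * b 4
        + 2 * (a * b 1 * b 3) - 4 * (a * (a * a)) + 4 * (a * (a * [:e:]))"
      unfolding scaled_det_def b(3) by Groebner_Basis.algebra
    also have "Polynomial.coeff \<dots> 6 = - 4 * (e * (e * e))"
      unfolding b a_def by (rule coeff_det_arc_moving_ends)
    finally have "scaled_det b a \<noteq> 0" using \<open>e \<noteq> 0\<close> by auto
    moreover have "4 * (e * \<alpha>) = 4 * (l 0 * l 4) - l 1 * l 3" using \<alpha> unfolding e_def by Groebner_Basis.algebra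
    then have "4 * ([:e:] * a) = 4 * (b 0 * b 4) - b 1 * b 3"
      unfolding b a_def by (rule quadric_arc_moving_ends)
    then have "12 * (a * a) = 4 * (b 2 * a) - b 1 * b 3 + 4 * (b 0 * b 4)"
      unfolding b(3) by Groebner_Basis.algebra
    moreover have "poly (b i) 0 = l i" for i by (simp add: b_def a_def e_def)
    ultimately show ?thesis using that by blast
  qed
qed

section \<open>Excluding dual vectors\<close>

abbreviation gradient_span :: "(5, 'k::field_char_0) mpoly set" where
  "gradient_span \<equiv> ideal_gen (range (hankel_grad Var))"

abbreviation minors_span :: "(5, 'k::field_char_0) mpoly set" where
  "minors_span \<equiv> ideal_gen (insert (central_minor Var) (range (hankel_grad Var)))"

text \<open>Up to the factor \<open>u\<close> the vector \<open>l\<close> is the derivative of the gradient in the direction \<open>v\<close>. Along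
  the arc \<open>x + t v\<close>, read modulo \<open>N\<close>, the minors have order at least 1. An element \<open>\<Sum> c\<^sub>i f\<^sub>i\<close> of \<open>J\<close>
  has the derivative \<open>u \<Sum> c\<^sub>i l\<^sub>i\<close>, which vanishes modulo \<open>N\<close>, so \<open>J\<close> has order at least 2. Hence the
  gradient also has order at least 2.\<close>

lemma dual_vector_in_prime_along_tangent:
  fixes J N :: "(5, 'k::field_char_0) mpoly set"
  assumes N: "prime_ideal N" and PN: "minors_span \<subseteq> N" and J: "J \<subseteq> gradient_span"
    and red: "ideal_power minors_span (Suc r) \<subseteq> ideal_mult J (ideal_power minors_span r)"
    and dual: "\<And>c. (\<Sum>i\<in>UNIV. c i * hankel_grad Var i) \<in> J \<Longrightarrow> (\<Sum>i\<in>UNIV. c i * l i) \<in> N"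
    and v: "\<And>i. hankel_polar Var v i - u * l i \<in> N"
  shows "u * l i \<in> N"
proof -
  have idN: "is_ideal N" using N by (simp add: prime_ideal_def)
  interpret c: comm_ring_hom "\<lambda>c :: 'k. [:Const c :: (5, 'k) mpoly:]"
    by (rule comm_ring_hom_comp[OF comm_ring_hom_Const comm_ring_hom_const_poly])
  define \<phi> where "\<phi> = subst (\<lambda>c :: 'k. [:Const c :: (5, 'k) mpoly:]) (\<lambda>i. [:Var i, v i:])"
  have \<phi>: "comm_ring_hom \<phi>" unfolding \<phi>_def by (rule c.comm_ring_hom_subst)
  interpret \<phi>: comm_ring_hom \<phi> by (rule \<phi>)
  have \<phi>0: "poly (\<phi> p) 0 = p" for p
  proof (rule mpoly_hom_eqI[OF comm_ring_hom_comp[OF \<phi> comm_ring_hom_poly_at] comm_ring_hom_id])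
    show "poly (\<phi> (Const c)) 0 = Const c" for c
      unfolding \<phi>_def c.subst_Const by simp
    show "poly (\<phi> (Var w)) 0 = Var w" for w
      unfolding \<phi>_def c.subst_Var by simp
  qed
  have \<phi>grad: "\<phi> (hankel_grad Var j) = [:hankel_grad Var j, hankel_polar Var v j, hankel_grad v j:]" for j
    unfolding \<phi>.hom_hankel_grad unfolding \<phi>_def c.subst_Var by (rule hankel_grad_pCons)
  have gradP: "hankel_grad Var j \<in> (minors_span :: (5, 'k) mpoly set)" for j by (rule self_module.span_base) auto
  then have gradN: "hankel_grad Var j \<in> N" for j using PN by blast
  let ?t = "[:0, 1:] :: (5, 'k) mpoly poly"
  let ?N = "{p. \<forall>n. Polynomial.coeff p n \<in> N}" and ?N' = "{p. poly p 0 \<in> N}"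
  have idN': "is_ideal ?N"
  proof (rule self_module.subspaceI)
    show "0 \<in> ?N" using ideal_0[OF idN] by simp
    show "p + q \<in> ?N" if "p \<in> ?N" "q \<in> ?N" for p q using that ideal_add[OF idN] by simp
    fix p q assume "q \<in> ?N"
    then have "Polynomial.coeff q k \<in> N" for k by blast
    then have "Polynomial.coeff (p * q) n \<in> N" for n
      unfolding Polynomial.coeff_mult by (intro ideal_sum[OF idN] ideal_scale[OF idN])
    then show "p * q \<in> ?N" by blast
  qed
  have split: "p - ?t * q = [:a:]" if "p = pCons a q" for p q :: "(5, 'k) mpoly poly" and a
    unfolding that by simp
  have const: "[:a:] \<in> ?N" if "a \<in> N" for a
    using that ideal_0[OF idN] by (simp add: Polynomial.coeff_pCons split: nat.split)
  have "[:hankel_polar Var v i, hankel_grad v i:] \<in> ?N'"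
  proof (rule reduction_along_hom[OF \<phi> idN', where d = ?t and P = minors_span and J = J and r = r])
    show "y \<in> ?N" if "?t * y \<in> ?N" for y
    proof -
      have "Polynomial.coeff (?t * y) (Suc n) \<in> N" for n using that by blast
      then show ?thesis by simp
    qed
    show "is_ideal ?N'"
    proof (rule self_module.subspaceI)
      show "0 \<in> ?N'" using ideal_0[OF idN] by simp
      show "p + q \<in> ?N'" if "p \<in> ?N'" "q \<in> ?N'" for p q using that ideal_add[OF idN] by simp
      show "p * q \<in> ?N'" if "q \<in> ?N'" for p q using that ideal_scale[OF idN] by simp
    qed
    show "?N \<subseteq> ?N'" by (auto simp: poly_0_coeff_0)
    show "y \<in> ?N'" if "y ^ n \<in> ?N'" for y n
      using that prime_ideal_power[OF N] by (simp add: poly_power)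
    show "\<exists>h. \<phi> p - ?t * h \<in> ?N" if "p \<in> minors_span" for p
    proof -
      obtain a q where aq: "\<phi> p = pCons a q" by (cases "\<phi> p")
      then have "a = p" using \<phi>0[of p] by simp
      then have "a \<in> N" using that PN by blast
      then show ?thesis using const[of a] unfolding split[OF aq, symmetric] by blast
    qed
    show "\<exists>h\<in>?N'. \<phi> p - ?t * h \<in> ?N" if p: "p \<in> J" for p
    proof -
      obtain c where c: "p = (\<Sum>i\<in>UNIV. c i * hankel_grad Var i)"
        using p J ideal_gen_range[of p "hankel_grad Var"] by blast
      obtain a q where aq: "\<phi> p = pCons a q" by (cases "\<phi> p")
      then have "a = p" using \<phi>0[of p] by simp
      moreover have "p \<in> minors_span"
        using p J self_module.span_mono[of "range (hankel_grad Var)" "insert (central_minor Var) (range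
            (hankel_grad Var))"] by blast
      ultimately have "a \<in> N" using PN by blast
      \<comment> \<open>The derivative of \<open>p\<close> along the arc is \<open>u\<close> times the value of \<open>l\<close> on its coefficients, up to \<open>N\<close>.\<close>
      have "poly q 0 = Polynomial.coeff (\<phi> p) 1" unfolding aq by (simp add: poly_0_coeff_0)
      also have "\<dots> = (\<Sum>i\<in>UNIV. Polynomial.coeff (\<phi> (c i) * [:hankel_grad Var i, hankel_polar Var v i, hankel_grad
          v i:]) 1)"
        unfolding c \<phi>.hom_sum \<phi>.hom_mult \<phi>grad Polynomial.coeff_sum ..
      also have "\<dots> = (\<Sum>i\<in>UNIV. (c i * (hankel_polar Var v i - u * l i) + Polynomial.coeff (\<phi> (c i)) 1 *
          hankel_grad Var i)
          + u * (c i * l i))"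
      proof (rule sum.cong[OF refl])
        fix j
        have "Polynomial.coeff (\<phi> (c j)) 0 = c j" using \<phi>0[of "c j"] by (simp add: poly_0_coeff_0)
        then show "Polynomial.coeff (\<phi> (c j) * [:hankel_grad Var j, hankel_polar Var v j, hankel_grad v j:]) 1
          = (c j * (hankel_polar Var v j - u * l j) + Polynomial.coeff (\<phi> (c j)) 1 * hankel_grad Var j) + u * (c j
              * l j)"
          by (simp add: Polynomial.coeff_mult right_diff_distrib mult.left_commute)
      qed
      also have "\<dots> = (\<Sum>i\<in>UNIV. c i * (hankel_polar Var v i - u * l i) + Polynomial.coeff (\<phi> (c i)) 1 * hankel_grad
          Var i)
          + u * (\<Sum>i\<in>UNIV. c i * l i)"
        unfolding sum.distrib[of "\<lambda>i. c i * (hankel_polar Var v i - u * l i) + Polynomial.coeff (\<phi> (c i)) 1 *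
            hankel_grad Var i"]
          sum_distrib_left ..
      also have "\<dots> \<in> N"
        by (rule ideal_add[OF idN ideal_sum[OF idN ideal_add[OF idN ideal_scale[OF idN v] ideal_scale[OF idN gradN]]]
              ideal_scale[OF idN dual[OF p[unfolded c]]]])
      finally have "q \<in> ?N'" by simp
      then show ?thesis using const[OF \<open>a \<in> N\<close>] unfolding split[OF aq, symmetric] by blast
    qed
    show "hankel_grad Var i \<in> (minors_span :: (5, 'k) mpoly set)" by (rule gradP)
    show "\<phi> (hankel_grad Var i) - ?t * [:hankel_polar Var v i, hankel_grad v i:] \<in> ?N"
      unfolding split[OF \<phi>grad] by (rule const[OF gradN])
    show "ideal_power minors_span (Suc r) \<subseteq> ideal_mult J (ideal_power minors_span r)" by (rule red)
  qed
  then have "hankel_polar Var v i \<in> N" by simp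
  from ideal_diff[OF idN this v[of i]] show ?thesis by simp
qed

text \<open>At the vertex the derivative of the gradient vanishes, and a linear arc \<open>t v\<close> does not realise
  every \<open>l\<close>: the adjugate of a matrix never has rank two, but the symmetric matrix with the entries \<open>l\<close>
  can. The arcs \<open>t \<cdot> adj (B t)\<close> do realise it, as along them the gradient is \<open>b\<close> times a common factor
  \<open>d\<close>, with \<open>b\<close> equal to \<open>l\<close> at \<open>t = 0\<close>. The extra factor \<open>t\<close> makes the arc start at the vertex, so that
  coefficients are evaluated to their constant terms.\<close>

lemma dual_vector_zero_at_vertex:
  fixes J :: "(5, 'k::field_char_0) mpoly set"
  assumes J: "J \<subseteq> gradient_span"
    and red: "ideal_power minors_span (Suc r) \<subseteq> ideal_mult J (ideal_power minors_span r)"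
    and dual: "\<And>c. (\<Sum>i\<in>UNIV. c i * hankel_grad Var i) \<in> J \<Longrightarrow> (\<Sum>i\<in>UNIV. const_part (c i) * l i) = 0"
  shows "l i = 0"
proof -
  interpret ac: comm_ring_hom "to_ac :: 'k \<Rightarrow> 'k alg_closure" by standard simp_all
  interpret c: comm_ring_hom "\<lambda>c :: 'k. [:to_ac c:]"
    by (rule comm_ring_hom_comp[OF ac.comm_ring_hom_axioms comm_ring_hom_const_poly])
  obtain b :: "5 \<Rightarrow> 'k alg_closure poly" and a
    where b0: "\<And>i. poly (b i) 0 = to_ac (l i)"
      and quadric: "12 * (a * a) = 4 * (b 2 * a) - b 1 * b 3 + 4 * (b 0 * b 4)"
      and disc: "scaled_det b a \<noteq> 0"
    using exists_arc_on_quadric[of "\<lambda>i. to_ac (l i)"] by blast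
  let ?t = "[:0, 1:] :: 'k alg_closure poly"
  define d where "d = ?t * ?t * (4 * scaled_det b a)"
  have "d \<noteq> 0" using disc by (simp add: d_def)
  define \<phi> where "\<phi> = subst (\<lambda>c. [:to_ac c:]) (\<lambda>i. 0 + ?t * scaled_adjugate b a i)"
  have \<phi>: "comm_ring_hom \<phi>" unfolding \<phi>_def by (rule c.comm_ring_hom_subst)
  interpret \<phi>: comm_ring_hom \<phi> by (rule \<phi>)
  have \<phi>0: "poly (\<phi> p) 0 = to_ac (const_part p)" for p
  proof (rule mpoly_hom_eqI[OF comm_ring_hom_comp[OF \<phi> comm_ring_hom_poly_at]
        comm_ring_hom_comp[OF comm_ring_hom_const_part ac.comm_ring_hom_axioms]])
    show "poly (\<phi> (Const c)) 0 = to_ac (const_part (Const c))" for c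
      unfolding \<phi>_def c.subst_Const const_part_Const by simp
    show "poly (\<phi> (Var w)) 0 = to_ac (const_part (Var w))" for w
      unfolding \<phi>_def c.subst_Var const_part_Var by simp
  qed
  have "hankel_grad (\<lambda>i. 0) j = (0 :: 'k alg_closure poly)" "hankel_polar (\<lambda>i. 0) w j = 0"
    for j and w :: "5 \<Rightarrow> 'k alg_closure poly"
    by (simp_all add: hankel_grad_def hankel_polar_def)
  then have \<phi>grad: "\<phi> (hankel_grad Var j) = d * b j" for j
    unfolding \<phi>.hom_hankel_grad unfolding \<phi>_def c.subst_Var hankel_grad_add_scale
        scaled_adjugate_inverts_minors(1)[OF quadric] d_def
    by (simp only: mult.assoc add_0_left mult_zero_right)
  have "\<phi> (central_minor Var) = ?t * ?t * central_minor (scaled_adjugate b a)"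
    unfolding \<phi>.hom_central_minor unfolding \<phi>_def c.subst_Var unfolding central_minor_def add_0_left
    by Groebner_Basis.algebra
  then have \<phi>centre: "\<phi> (central_minor Var) = d * a"
    unfolding scaled_adjugate_inverts_minors(2)[OF quadric] d_def by (simp only: mult.assoc)
  have "b i \<in> {p. poly p 0 = 0}"
  proof (rule reduction_along_hom[OF \<phi>, where N = "{0}" and d = d and P = minors_span and J = J and r = r])
    show "is_ideal {0 :: 'k alg_closure poly}" by (rule self_module.subspace_single_0)
    show "y \<in> {0}" if "d * y \<in> {0}" for y using that \<open>d \<noteq> 0\<close> by simp
    show "is_ideal {p :: 'k alg_closure poly. poly p 0 = 0}" by (rule self_module.subspaceI) simp_all
    show "{0} \<subseteq> {p :: 'k alg_closure poly. poly p 0 = 0}" by simp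
    show "y \<in> {p :: 'k alg_closure poly. poly p 0 = 0}" if "y ^ n \<in> {p. poly p 0 = 0}" for y n
      using that by (simp add: poly_power)
    show "\<exists>h. \<phi> p - d * h \<in> {0}" if p_in: "p \<in> minors_span" for p
    proof -
      obtain s c where p: "p = s * central_minor Var + (\<Sum>i\<in>UNIV. c i * hankel_grad Var i)"
        using p_in by (rule ideal_gen_insert_range)
      have "\<phi> p = d * (\<phi> s * a + (\<Sum>i\<in>UNIV. \<phi> (c i) * b i))"
        unfolding p \<phi>.hom_add \<phi>.hom_mult \<phi>.hom_sum \<phi>centre \<phi>grad distrib_left sum_distrib_left
        by (simp only: mult.left_commute[of _ d])
      then show ?thesis by auto
    qed
    show "\<exists>h\<in>{p. poly p 0 = 0}. \<phi> p - d * h \<in> {0}" if p: "p \<in> J" for p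
    proof -
      obtain c where c: "p = (\<Sum>i\<in>UNIV. c i * hankel_grad Var i)"
        using p J ideal_gen_range[of p "hankel_grad Var"] by blast
      have "\<phi> p = d * (\<Sum>i\<in>UNIV. \<phi> (c i) * b i)"
        unfolding c \<phi>.hom_mult \<phi>.hom_sum \<phi>grad sum_distrib_left by (simp only: mult.left_commute[of _ d])
      moreover have "poly (\<Sum>i\<in>UNIV. \<phi> (c i) * b i) 0 = to_ac (\<Sum>i\<in>UNIV. const_part (c i) * l i)"
        by (simp only: poly_sum poly_mult \<phi>0 b0 ac.hom_sum ac.hom_mult)
      then have "poly (\<Sum>i\<in>UNIV. \<phi> (c i) * b i) 0 = 0" using dual[of c] p[unfolded c] by simp
      ultimately show ?thesis by (intro bexI[of _ "\<Sum>i\<in>UNIV. \<phi> (c i) * b i"]) simp_all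
    qed
    show "hankel_grad Var i \<in> (minors_span :: (5, 'k) mpoly set)" by (rule self_module.span_base) auto
    show "\<phi> (hankel_grad Var i) - d * b i \<in> {0}" unfolding \<phi>grad by simp
    show "ideal_power minors_span (Suc r) \<subseteq> ideal_mult J (ideal_power minors_span r)" by (rule red)
  qed
  then show ?thesis using b0[of i] by simp
qed

text \<open>In degree two membership would make the central minor a linear combination of the partial
  derivatives with constant coefficients. Two points decide this: both have all partial derivatives zero
  except the middle one, but the central minor vanishes only at the first.\<close>

lemma central_minor_not_in_gradient_span: "central_minor Var \<notin> (gradient_span :: (5, 'k::field_char_0) mpoly set)"
proof
  assume "central_minor Var \<in> (gradient_span :: (5, 'k) mpoly set)"
  then obtain c :: "5 \<Rightarrow> (5, 'k) mpoly" where c: "central_minor Var = (\<Sum>i\<in>UNIV. c i * hankel_grad Var i)"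
    by (rule ideal_gen_range)
  interpret k: comm_ring_hom "\<lambda>c :: 'k. [:c:]" by (rule comm_ring_hom_const_poly)
  let ?t = "[:0, 1:] :: 'k poly"
  have quad: "central_minor w = (\<Sum>i\<in>UNIV. const_part (c i) * hankel_grad w i)" for w :: "5 \<Rightarrow> 'k"
  proof -
    define \<phi> where "\<phi> = subst (\<lambda>c. [:c:]) (\<lambda>i. [:0, w i:])"
    have \<phi>: "comm_ring_hom \<phi>" unfolding \<phi>_def by (rule k.comm_ring_hom_subst)
    interpret \<phi>: comm_ring_hom \<phi> by (rule \<phi>)
    have \<phi>0: "poly (\<phi> p) 0 = const_part p" for p
    proof (rule mpoly_hom_eqI[OF comm_ring_hom_comp[OF \<phi> comm_ring_hom_poly_at] comm_ring_hom_const_part])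
      show "poly (\<phi> (Const c)) 0 = const_part (Const c)" for c
        unfolding \<phi>_def k.subst_Const const_part_Const by simp
      show "poly (\<phi> (Var w)) 0 = const_part (Var w)" for w
        unfolding \<phi>_def k.subst_Var const_part_Var by simp
    qed
    have "hankel_grad (\<lambda>i. 0) j = (0 :: 'k)" "hankel_polar (\<lambda>i. 0) w j = 0" for j
      by (simp_all add: hankel_grad_def hankel_polar_def)
    then have \<phi>grad: "\<phi> (hankel_grad Var j) = [:0, 0, hankel_grad w j:]" for j
      unfolding \<phi>.hom_hankel_grad unfolding \<phi>_def k.subst_Var hankel_grad_pCons by (simp only:)
    have shift: "[:0, 0, y:] = ?t * ?t * [:y:]" for y by simp
    have "\<phi> (central_minor Var) = ?t * ?t * [:central_minor w:]"
      unfolding \<phi>.hom_central_minor unfolding \<phi>_def k.subst_Var central_minor_def by simp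
    moreover have "\<phi> (central_minor Var) = ?t * ?t * (\<Sum>i\<in>UNIV. \<phi> (c i) * [:hankel_grad w i:])"
      unfolding c \<phi>.hom_sum \<phi>.hom_mult \<phi>grad shift sum_distrib_left
      by (simp only: mult.left_commute[of _ "?t * ?t"])
    ultimately have eq: "?t * ?t * [:central_minor w:] = ?t * ?t * (\<Sum>i\<in>UNIV. \<phi> (c i) * [:hankel_grad w i:])"
      by (simp only:)
    have "?t * ?t \<noteq> 0" by simp
    then have "[:central_minor w:] = (\<Sum>i\<in>UNIV. \<phi> (c i) * [:hankel_grad w i:])"
      by (rule mult_left_cancel[THEN iffD1, OF _ eq])
    then have "poly [:central_minor w:] 0 = poly (\<Sum>i\<in>UNIV. \<phi> (c i) * [:hankel_grad w i:]) 0" by simp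
    then show ?thesis by (simp only: poly_sum poly_mult \<phi>0 poly_pCons poly_0 mult_zero_right mult_zero_left add_0_right)
  qed
  \<comment> \<open>The points \<open>(1, 0, 0, 0, 1)\<close> and \<open>(0, 0, 1, 0, 0)\<close>.\<close>
  have "const_part (c 2) = 0"
    using quad[of "\<lambda>i. if i = 0 \<or> i = 4 then 1 else 0"] unfolding sum_5 hankel_grad_simps central_minor_def by simp
  moreover have "const_part (c 2) * 3 = 1"
    using quad[of "\<lambda>i. if i = 2 then 1 else 0"] unfolding sum_5 hankel_grad_simps central_minor_def by simp
  ultimately show False by simp
qed

section \<open>The gradient ideal as a minimal reduction\<close>

lemma minors_square_subset:
  "ideal_mult minors_span minors_span \<subseteq> ideal_mult gradient_span (minors_span :: (5, 'k::field_char_0) mpoly set)"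
proof (rule ideal_mult_span_insert_square)
  let ?x = "Var :: 5 \<Rightarrow> (5, 'k) mpoly"
  let ?JP = "ideal_mult gradient_span (minors_span :: (5, 'k) mpoly set)"
  show "is_ideal (gradient_span :: (5, 'k) mpoly set)" by (rule self_module.subspace_span)
  show "(minors_span :: (5, 'k) mpoly set) = ideal_gen (insert (central_minor ?x) gradient_span)"
    unfolding self_module.span_insert self_module.span_span ..
  have JP: "is_ideal ?JP" by (rule is_ideal_ideal_mult)
  have f: "hankel_grad ?x i \<in> gradient_span" "hankel_grad ?x i \<in> minors_span" "central_minor ?x \<in> minors_span" for i
    by (auto intro: self_module.span_base)
  have "12 * (central_minor ?x * central_minor ?x) \<in> ?JP"
    unfolding central_minor_square
    by (rule ideal_add[OF JP ideal_diff[OF JP ideal_scale[OF JP ideal_mult_memI[OF f(1,3)]]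
          ideal_mult_memI[OF f(1,2)]] ideal_scale[OF JP ideal_mult_memI[OF f(1,2)]]])
  then show "central_minor ?x * central_minor ?x \<in> ?JP" by (rule ideal_cancel_numeral[OF JP])
qed

text \<open>On the cone, \<open>x\<^sub>1\<^sup>2 = x\<^sub>0 x\<^sub>2\<close>, \<open>x\<^sub>3\<^sup>2 = x\<^sub>2 x\<^sub>4\<close> and \<open>x\<^sub>2\<^sup>2 = x\<^sub>1 x\<^sub>3\<close>, so the two end
  coordinates vanish together only at the vertex.\<close>

lemma vertex_in_ideal:
  fixes x :: "5 \<Rightarrow> 'a::comm_ring_1"
  assumes N: "prime_ideal N" and grad: "\<And>i. hankel_grad x i \<in> N" and centre: "central_minor x \<in> N"
    and ends: "x 0 \<in> N" "x 4 \<in> N"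
  shows "x i \<in> N"
proof -
  have idN: "is_ideal N" using N by (simp add: prime_ideal_def)
  have sq: "y \<in> N" if "z - y * y \<in> N" "z \<in> N" for y z
  proof -
    have "z - (z - y * y) \<in> N" by (rule ideal_diff[OF idN that(2,1)])
    then have "y ^ 2 \<in> N" by (simp add: power2_eq_square)
    then show ?thesis by (rule prime_ideal_power[OF N])
  qed
  have 1: "x 1 \<in> N"
    using sq[OF grad[of 4, unfolded hankel_grad_simps] ideal_scale'[OF idN ends(1)]] .
  have 3: "x 3 \<in> N"
    using sq[OF grad[of 0, unfolded hankel_grad_simps] ideal_scale[OF idN ends(2)]] .
  have 2: "x 2 \<in> N"
    using sq[OF centre[unfolded central_minor_def] ideal_scale[OF idN 3]] .
  have "\<forall>i. x i \<in> N" unfolding all_5 using ends 1 2 3 by (intro conjI)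
  then show ?thesis by blast
qed

text \<open>The colon ideal \<open>A\<close> of \<open>J\<close> in the gradient ideal is shown to be the unit ideal. Otherwise some
  prime ideal \<open>N\<close> contains it, and \<open>N\<close> contains the minors because \<open>A\<close> contains a power of each of them.
  As \<open>A \<subseteq> N\<close>, linear algebra at \<open>N\<close> gives a dual vector \<open>l\<close>. It satisfies the syzygies of the gradient
  modulo \<open>N\<close>, because a syzygy represents the element 0 of \<open>J\<close>. Tangential arcs show that \<open>N\<close> contains
  \<open>x\<^sub>0\<close> and \<open>x\<^sub>4\<close>, hence all variables, and the arcs through the vertex exclude the remaining case.\<close>

lemma subideal_reduction_eq:
  fixes J :: "(5, 'k::field_char_0) mpoly set"
  assumes idJ: "is_ideal J" and J: "J \<subseteq> gradient_span"
    and red: "ideal_power minors_span (Suc r) \<subseteq> ideal_mult J (ideal_power minors_span r)"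
  shows "J = gradient_span"
proof -
  let ?x = "Var :: 5 \<Rightarrow> (5, 'k) mpoly"
  define A where "A = {s. \<forall>i. s * hankel_grad ?x i \<in> J}"
  have idA: "is_ideal A"
  proof (rule self_module.subspaceI)
    show "0 \<in> A" using ideal_0[OF idJ] by (simp add: A_def)
  next
    fix s t assume "s \<in> A" "t \<in> A"
    then show "s + t \<in> A" using ideal_add[OF idJ] by (simp add: A_def distrib_right)
  next
    fix s t assume "t \<in> A"
    then show "s * t \<in> A" using ideal_scale[OF idJ] by (simp add: A_def mult.assoc)
  qed
  have "1 \<in> A"
  proof (rule ccontr)
    assume "1 \<notin> A"
    with idA obtain N where N: "prime_ideal N" and AN: "A \<subseteq> N" by (rule exists_prime_ideal_above)
    have idN: "is_ideal N" and oneN: "1 \<notin> N" and prN: "\<And>p q. p * q \<in> N \<Longrightarrow> p \<in> N \<or> q \<in> N"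
      using N by (simp_all add: prime_ideal_def)
    have "J \<subseteq> A" using ideal_scale'[OF idJ] by (auto simp: A_def)
    have PN: "minors_span \<subseteq> N"
    proof
      fix p :: "(5, 'k) mpoly" assume "p \<in> minors_span"
      then have "p ^ Suc r \<in> ideal_mult J (ideal_power minors_span r)"
        using power_mem_ideal_power red by blast
      also have "\<dots> \<subseteq> J" using ideal_scale'[OF idJ] by (rule ideal_mult_least[OF idJ])
      finally have "p ^ Suc r \<in> N" using \<open>J \<subseteq> A\<close> AN by blast
      then show "p \<in> N" by (rule prime_ideal_power[OF N])
    qed
    have gradN: "hankel_grad ?x i \<in> N" for i by (rule subsetD[OF PN self_module.span_base]) auto
    have centreN: "central_minor ?x \<in> N" by (rule subsetD[OF PN self_module.span_base]) auto
    define M where "M = {c. (\<Sum>i\<in>UNIV. c i * hankel_grad ?x i) \<in> J}"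
    have M_add: "(\<lambda>i. c i + d i) \<in> M" if "c \<in> M" "d \<in> M" for c d
      using ideal_add[OF idJ, of "\<Sum>i\<in>UNIV. c i * hankel_grad ?x i" "\<Sum>i\<in>UNIV. d i * hankel_grad ?x i"] that
      by (simp add: M_def sum.distrib distrib_right)
    have M_scale: "(\<lambda>i. s * c i) \<in> M" if "c \<in> M" for s c
      using ideal_scale[OF idJ, of "\<Sum>i\<in>UNIV. c i * hankel_grad ?x i" s] that
      by (simp add: M_def sum_distrib_left mult.assoc)
    have M_zero: "(\<lambda>i. 0) \<in> M" using ideal_0[OF idJ] by (simp add: M_def)
    show False
    proof (rule dual_vector_cases[of N M])
      show "prime_ideal N" by (rule N)
      show "(\<lambda>i. c i + d i) \<in> M" if "c \<in> M" "d \<in> M" for c d using that by (rule M_add)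
      show "(\<lambda>i. s * c i) \<in> M" if "c \<in> M" for s c using that by (rule M_scale)
      show "(\<lambda>i. 0) \<in> M" by (rule M_zero)
    next
      fix s assume s: "s \<notin> N" "\<And>d. (\<lambda>i. s * d i) \<in> M"
      have "s * hankel_grad ?x j \<in> J" for j
      proof -
        have "(\<Sum>i\<in>UNIV. s * (if i = j then 1 else 0) * hankel_grad ?x i) \<in> J"
          using s(2)[of "\<lambda>i. if i = j then 1 else 0"] by (simp only: M_def mem_Collect_eq)
        moreover have "(\<Sum>i\<in>UNIV. s * (if i = j then 1 else 0) * hankel_grad ?x i)
          = (\<Sum>i\<in>UNIV. if i = j then s * hankel_grad ?x i else 0)" by (intro sum.cong) auto
        ultimately show ?thesis by simp
      qed
      then have "s \<in> A" by (simp add: A_def)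
      then show False using s(1) AN by blast
    next
      fix l k assume "l k \<notin> N" and M: "\<And>c. c \<in> M \<Longrightarrow> (\<Sum>i\<in>UNIV. c i * l i) \<in> N"
      have dual: "(\<Sum>i\<in>UNIV. c i * l i) \<in> N" if "(\<Sum>i\<in>UNIV. c i * hankel_grad ?x i) \<in> J" for c
        using that by (intro M) (simp add: M_def)
      have syz: "c0 * l 0 + c1 * l 1 + c2 * l 2 + c3 * l 3 + c4 * l 4 \<in> N"
        if "c0 * hankel_grad ?x 0 + c1 * hankel_grad ?x 1 + c2 * hankel_grad ?x 2 + c3 * hankel_grad ?x 3 + c4 *
            hankel_grad ?x 4 = 0"
        for c0 c1 c2 c3 c4
        using dual[of "\<lambda>i. if i = 0 then c0 else if i = 1 then c1 else if i = 2 then c2 else if i = 3 then c3 else c4"]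
          that ideal_0[OF idJ] by (simp add: sum_5)
      have "0 * hankel_grad ?x 0 + ?x 0 * hankel_grad ?x 1 + (2 * ?x 1) * hankel_grad ?x 2 + (3 * ?x 2) *
          hankel_grad ?x 3 + (4 * ?x 3) * hankel_grad ?x 4 = 0"
        using hankel_grad_syzygies(1)[of ?x] by (simp only: mult.assoc mult_zero_left add_0_left)
      from syz[OF this] have syz1: "?x 0 * l 1 + 2 * (?x 1 * l 2) + 3 * (?x 2 * l 3) + 4 * (?x 3 * l 4) \<in> N"
        by (simp only: mult.assoc mult_zero_left add_0_left)
      have "(4 * ?x 1) * hankel_grad ?x 0 + (3 * ?x 2) * hankel_grad ?x 1 + (2 * ?x 3) * hankel_grad ?x 2 + ?x 4 *
          hankel_grad ?x 3 + 0 * hankel_grad ?x 4 = 0"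
        using hankel_grad_syzygies(2)[of ?x] by Groebner_Basis.algebra
      from syz[OF this] have syz2: "?x 4 * l 3 + 2 * (?x 3 * l 2) + 3 * (?x 2 * l 1) + 4 * (?x 1 * l 0) \<in> N"
        by (simp only: mult.assoc mult_zero_left add_0_left add_0_right ac_simps)
      have "(- 2 * ?x 0) * hankel_grad ?x 0 + (- ?x 1) * hankel_grad ?x 1 + 0 * hankel_grad ?x 2 + ?x 3 *
          hankel_grad ?x 3 + (2 * ?x 4) * hankel_grad ?x 4 = 0"
        using hankel_grad_syzygies(3)[of ?x] by Groebner_Basis.algebra
      note syz[OF this]
      moreover have "(- 2 * ?x 0) * l 0 + (- ?x 1) * l 1 + 0 * l 2 + ?x 3 * l 3 + (2 * ?x 4) * l 4
        = 2 * (?x 4 * l 4) + ?x 3 * l 3 - ?x 1 * l 1 - 2 * (?x 0 * l 0)" by Groebner_Basis.algebra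
      ultimately have syz3: "2 * (?x 4 * l 4) + ?x 3 * l 3 - ?x 1 * l 1 - 2 * (?x 0 * l 0) \<in> N"
        by (simp only:)
      have end_in: "?x j \<in> N" if v: "\<exists>v. \<forall>i. hankel_polar ?x v i - 4 * ?x j ^ 3 * l i \<in> N" for j
      proof -
        from v obtain v where v': "\<And>i. hankel_polar ?x v i - 4 * ?x j ^ 3 * l i \<in> N" by blast
        have "4 * ?x j ^ 3 * l k \<in> N" using N PN J red dual v' by (rule dual_vector_in_prime_along_tangent)
        then have "4 * ?x j ^ 3 \<in> N" using prN \<open>l k \<notin> N\<close> by blast
        then have "?x j ^ 3 \<in> N" by (rule ideal_cancel_numeral[OF idN])
        then show ?thesis by (rule prime_ideal_power[OF N])
      qed
      have "?x 0 \<in> N" by (rule end_in[OF hankel_polar_solvable_0[OF idN gradN centreN syz1 syz3]])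
      moreover have "?x 4 \<in> N" by (rule end_in[OF hankel_polar_solvable_4[OF idN gradN centreN syz2 syz3]])
      ultimately have xN: "?x i \<in> N" for i by (rule vertex_in_ideal[OF N gradN centreN])
      interpret c: comm_ring_hom "const_part :: (5, 'k) mpoly \<Rightarrow> 'k" by (rule comm_ring_hom_const_part)
      have const0: "const_part p = 0" if "p \<in> N" for p
      proof (rule ccontr)
        assume k: "const_part p \<noteq> 0"
        have "p - (p - Const (const_part p)) \<in> N"
          by (rule ideal_diff[OF idN that diff_const_part_in_ideal[OF idN xN]])
        then have "Const (const_part p) \<in> N" by simp
        then have "Const (1 / const_part p) * Const (const_part p) \<in> N" by (rule ideal_scale[OF idN])
        then show False using k oneN unfolding mult_single by simp
      qed
      have "const_part (l k) = 0"
      proof (rule dual_vector_zero_at_vertex[OF J red])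
        fix c assume "(\<Sum>i\<in>UNIV. c i * hankel_grad ?x i) \<in> J"
        from const0[OF dual[OF this]] show "(\<Sum>i\<in>UNIV. const_part (c i) * const_part (l i)) = 0"
          by (simp only: c.hom_sum c.hom_mult)
      qed
      then have "l k \<in> N" using diff_const_part_in_ideal[OF idN xN, of "l k"] by simp
      then show False using \<open>l k \<notin> N\<close> by blast
    qed
  qed
  then have "range (hankel_grad ?x) \<subseteq> J" by (auto simp: A_def)
  then show ?thesis using J self_module.span_minimal[OF _ idJ] by blast
qed

theorem proposition3p21:
  fixes J P :: "(5, 'k::field_char_0) mpoly set"
  assumes "J = gradient_ideal (det hankel3)"
    and "P = minors_ideal 2 hankel3"
  shows "ideal_power P 2 \<subseteq> ideal_mult J P
    \<and> is_minimal_reduction J P \<and> reduction_number J P = 1"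
proof -
  have J: "J = gradient_span" and P: "P = minors_span"
    using assms by (simp_all only: gradient_ideal_hankel3 minors_ideal_hankel3)
  have idJ: "is_ideal J" and idP: "is_ideal P" unfolding J P by (rule self_module.subspace_span)+
  have JP: "J \<subseteq> P" unfolding J P by (rule self_module.span_mono) blast
  have P1: "ideal_power P 1 = P" using ideal_power_1[OF idP] by simp
  have P2: "ideal_power P 2 = ideal_mult P P"
    unfolding numeral_2_eq_2 using ideal_power_1[OF idP] by simp
  have sub: "ideal_power P 2 \<subseteq> ideal_mult J P" unfolding P2 unfolding J P by (rule minors_square_subset)
  have eq1: "ideal_power P (1 + 1) = ideal_mult J (ideal_power P 1)"
  proof
    show "ideal_power P (1 + 1) \<subseteq> ideal_mult J (ideal_power P 1)" using sub unfolding P1 one_add_one .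
    show "ideal_mult J (ideal_power P 1) \<subseteq> ideal_power P (1 + 1)"
      using ideal_mult_mono[OF JP order_refl] unfolding P1 one_add_one P2 .
  qed
  have red: "is_reduction J P" unfolding is_reduction_def using idJ JP eq1 by blast
  have "\<not> (\<exists>J'. is_reduction J' P \<and> J' \<subset> J)"
  proof
    assume "\<exists>J'. is_reduction J' P \<and> J' \<subset> J"
    then obtain J' r where J': "is_ideal J'" "J' \<subset> J"
      and r: "ideal_power P (Suc r) = ideal_mult J' (ideal_power P r)"
      unfolding is_reduction_def by auto
    have "J' = gradient_span"
      using J'(1) psubset_imp_subset[OF J'(2), unfolded J] equalityD1[OF r, unfolded P]
      by (rule subideal_reduction_eq)
    then show False using J'(2) unfolding J by blast
  qed
  moreover have "reduction_number J P = 1"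
    unfolding reduction_number_def
  proof (rule Least_equality)
    show "ideal_power P (1 + 1) = ideal_mult J (ideal_power P 1)" by (rule eq1)
  next
    fix r assume r: "ideal_power P (r + 1) = ideal_mult J (ideal_power P r)"
    have "r \<noteq> 0"
    proof
      assume "r = 0"
      then have "P = J" using r P1 ideal_mult_UNIV[OF idJ] by simp
      moreover have "central_minor Var \<in> P" unfolding P by (rule self_module.span_base) blast
      ultimately show False using central_minor_not_in_gradient_span unfolding J by blast
    qed
    then show "1 \<le> r" by simp
  qed
  ultimately show ?thesis using sub red unfolding is_minimal_reduction_def by blast
qed

end
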